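(* Let $F$ be a field. The Lie algebra $\mathrm{Prim}\,F\Pi$ of all $\Delta$-primitive elements of $F\Pi$ is $$\mathrm{Prim}\,F\Pi=\bigoplus_{A}e_A\wedge F\Pi_A,$$ where $A$ ranges over all non-empty finite subsets of $\mathbb N$. For each such $A$, with $n=\#A$, the $A$-graded component $e_A\wedge F\Pi_A$ is equal to the $F$-linear span of all idempotents $e\in F\Pi_A$ (with respect to $\wedge$) such that $e\wedge F\Pi_A=e_A\wedge F\Pi_A$, and it has dimension $2\,\#\Pi_{n-1}$.
   Context: For a finite subset $A$ of $\mathbb N=\{1,2,\ldots\}$, a set composition of $A$ is a tuple $P=(P_1,\ldots,P_l)$ of mutually disjoint non-empty subsets of $A$ with union $A$; its length is $\ell(P)=l$; $\Pi_A$ is the set of all set compositions of $A$, and $\Pi_n=\Pi_{\{1,\ldots,n\}}$, with $\Pi_0=\Pi_\emptyset$. $\Pi_\emptyset$ consists of the empty tuple, denoted $\emptyset$. $F\Pi_A$ is the $F$-vector space with basis $\Pi_A$ and $F\Pi=\bigoplus_AF\Pi_A$ over all finite $A\subset\mathbb N$. Bilinear products on $F\Pi$: for $P=(P_1,\ldots,P_l)\in\Pi_A$, $Q=(Q_1,\ldots,Q_k)\in\Pi_B$, $P\wedge Q=(P_1\cap Q_1,\ldots,P_1\cap Q_k,\ldots,P_l\cap Q_1,\ldots,P_l\cap Q_k)$ with empty sets deleted if $A=B$, and $0$ if $A\neq B$; $P\vee Q=(P_1,\ldots,P_l,Q_1,\ldots,Q_k)$ if $A\cap B=\emptyset$, and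 $0$ otherwise. The Lie product on $F\Pi$ is $f\circ g=f\vee g-g\vee f$. Coproduct: the linear map $\Delta:F\Pi\to F\Pi\otimes F\Pi$ with $\Delta(P)=\sum_{X\subseteq A}P|_X\otimes P|_{A\setminus X}$ for $P\in\Pi_A$, where $P|_X$ is $(P_1\cap X,\ldots,P_l\cap X)$ with empty sets deleted. An element $E\in F\Pi$ is $\Delta$-primitive if $\Delta(E)=E\otimes\emptyset+\emptyset\otimes E$; these elements form a Lie subalgebra $\mathrm{Prim}\,F\Pi$ of $(F\Pi,\circ)$. For non-empty $A$: $e_A=\sum_P(-1)^{\ell(P)-1}P$, the sum over all $P=(P_1,\ldots,P_l)\in\Pi_A$ with $\min A\in P_1$. An idempotent is an element $e\neq0$ with $e\wedge e=e$.
   Formalization: The dimension formula 2·#Π_{n-1} is false for n = 1 (it gives 2, but e_A∧FΠ_A is then one-dimensional); it is proved for n ≥ 2, and dimension 1 is proved for n = 1. *)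

theory Defs
  imports Complex_Main "HOL-Library.Poly_Mapping" "HOL-Library.Disjoint_Sets"
begin

definition fscale :: "'a::field \<Rightarrow> ('b \<Rightarrow>\<^sub>0 'a) \<Rightarrow> ('b \<Rightarrow>\<^sub>0 'a)" where
  "fscale c f = Poly_Mapping.map ((*) c) f"

lemma lookup_fscale [simp]: "Poly_Mapping.lookup (fscale c f) x = c * Poly_Mapping.lookup f x"
  unfolding fscale_def by (transfer fixing: c) (simp add: when_def)

global_interpretation free_vs: vector_space "fscale :: 'a::field \<Rightarrow> ('b \<Rightarrow>\<^sub>0 'a) \<Rightarrow> ('b \<Rightarrow>\<^sub>0 'a)"
  by unfold_locales (auto intro!: poly_mapping_eqI simp: lookup_add algebra_simps)

definition linear_ext :: "('b \<Rightarrow> ('c \<Rightarrow>\<^sub>0 'a::field)) \<Rightarrow> ('b \<Rightarrow>\<^sub>0 'a) \<Rightarrow> ('c \<Rightarrow>\<^sub>0 'a)" where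
  "linear_ext m f = (\<Sum>P\<in>Poly_Mapping.keys f. fscale (Poly_Mapping.lookup f P) (m P))"

definition bilinear_ext ::
  "('b \<Rightarrow> 'c \<Rightarrow> ('d \<Rightarrow>\<^sub>0 'a::field)) \<Rightarrow> ('b \<Rightarrow>\<^sub>0 'a) \<Rightarrow> ('c \<Rightarrow>\<^sub>0 'a) \<Rightarrow> ('d \<Rightarrow>\<^sub>0 'a)" where
  "bilinear_ext m f g =
     (\<Sum>P\<in>Poly_Mapping.keys f. \<Sum>Q\<in>Poly_Mapping.keys g. fscale (Poly_Mapping.lookup f P * Poly_Mapping.lookup g Q) (m P Q))"

text \<open>The tensor product of the free vector spaces on two sets is modelled by the free
  vector space on the product of the two sets.\<close>

definition tensor :: "('b \<Rightarrow>\<^sub>0 'a::field) \<Rightarrow> ('c \<Rightarrow>\<^sub>0 'a) \<Rightarrow> ('b \<times> 'c \<Rightarrow>\<^sub>0 'a)" (infixr "\<otimes>" 75) where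
  "f \<otimes> g = bilinear_ext (\<lambda>P Q. Poly_Mapping.single (P, Q) 1) f g"

text \<open>\<open>V\<close> is the internal direct sum of the subspaces \<open>W i\<close>, \<open>i \<in> I\<close>: every element of \<open>V\<close>
  is a finite sum of elements of the \<open>W i\<close>, all such sums lie in \<open>V\<close>, and the \<open>W i\<close> are
  independent.\<close>

definition internal_direct_sum ::
  "'i set \<Rightarrow> ('i \<Rightarrow> ('b \<Rightarrow>\<^sub>0 'a::field) set) \<Rightarrow> ('b \<Rightarrow>\<^sub>0 'a) set \<Rightarrow> bool" where
  "internal_direct_sum I W V \<longleftrightarrow>
     (\<forall>i\<in>I. free_vs.subspace (W i)) \<and>
     V = {(\<Sum>i\<in>J. w i) | J w. finite J \<and> J \<subseteq> I \<and> (\<forall>i\<in>J. w i \<in> W i)} \<and>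
     (\<forall>J w. finite J \<and> J \<subseteq> I \<and> (\<forall>i\<in>J. w i \<in> W i) \<and> (\<Sum>i\<in>J. w i) = 0
        \<longrightarrow> (\<forall>i\<in>J. w i = 0))"

definition set_comps :: "nat set \<Rightarrow> nat set list set" where
  "set_comps A = {P. {} \<notin> set P \<and> disjoint_family_on ((!) P) {..<length P} \<and> \<Union>(set P) = A}"

definition fin_subsets :: "nat set set" where
  "fin_subsets = {A. finite A \<and> A \<subseteq> {1..}}"

text \<open>Elements of \<open>F\<Pi>\<close> are finitely supported functions on lists of sets; the subspaces
  \<open>FPi_comp A\<close> and \<open>FPi\<close> restrict the support to genuine set compositions.\<close>

type_synonym 'a fpi = "nat set list \<Rightarrow>\<^sub>0 'a"

definition FPi_comp :: "nat set \<Rightarrow> 'a::field fpi set" where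
  "FPi_comp A = {f. Poly_Mapping.keys f \<subseteq> set_comps A}"

definition FPi :: "'a::field fpi set" where
  "FPi = {f. Poly_Mapping.keys f \<subseteq> (\<Union>A\<in>fin_subsets. set_comps A)}"

text \<open>A set composition \<open>P\<close> of \<open>A\<close> determines \<open>A = \<Union>(set P)\<close>.\<close>

definition basis_wedge :: "nat set list \<Rightarrow> nat set list \<Rightarrow> 'a::field fpi" where
  "basis_wedge P Q =
     (if \<Union>(set P) = \<Union>(set Q)
      then Poly_Mapping.single (filter (\<lambda>X. X \<noteq> {}) [X \<inter> Y. X \<leftarrow> P, Y \<leftarrow> Q]) 1 else 0)"

definition basis_vee :: "nat set list \<Rightarrow> nat set list \<Rightarrow> 'a::field fpi" where
  "basis_vee P Q =
     (if \<Union>(set P) \<inter> \<Union>(set Q) = {} then Poly_Mapping.single (P @ Q) 1 else 0)"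

definition wedge :: "'a::field fpi \<Rightarrow> 'a fpi \<Rightarrow> 'a fpi" (infixl "\<curlywedge>" 70) where
  "f \<curlywedge> g = bilinear_ext basis_wedge f g"

definition vee :: "'a::field fpi \<Rightarrow> 'a fpi \<Rightarrow> 'a fpi" (infixl "\<curlyvee>" 70) where
  "f \<curlyvee> g = bilinear_ext basis_vee f g"

definition lie_prod :: "'a::field fpi \<Rightarrow> 'a fpi \<Rightarrow> 'a fpi" where
  "lie_prod f g = f \<curlyvee> g - g \<curlyvee> f"

definition lie_subalgebra :: "'a::field fpi set \<Rightarrow> bool" where
  "lie_subalgebra L \<longleftrightarrow>
     L \<subseteq> FPi \<and> free_vs.subspace L \<and> (\<forall>f\<in>L. \<forall>g\<in>L. lie_prod f g \<in> L)"

definition restr :: "nat set list \<Rightarrow> nat set \<Rightarrow> nat set list" where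
  "restr P X = filter (\<lambda>Y. Y \<noteq> {}) (map (\<lambda>Y. Y \<inter> X) P)"

definition coprod :: "'a::field fpi \<Rightarrow> (nat set list \<times> nat set list \<Rightarrow>\<^sub>0 'a)" where
  "coprod = linear_ext (\<lambda>P. \<Sum>X\<in>Pow (\<Union>(set P)).
     Poly_Mapping.single (restr P X) 1 \<otimes> Poly_Mapping.single (restr P (\<Union>(set P) - X)) 1)"

definition empty_comp :: "'a::field fpi" where
  "empty_comp = Poly_Mapping.single [] 1"

definition Prim :: "'a::field fpi set" where
  "Prim = {E \<in> FPi. coprod E = E \<otimes> empty_comp + empty_comp \<otimes> E}"

definition e_elem :: "nat set \<Rightarrow> 'a::field fpi" where
  "e_elem A = (\<Sum>P | P \<in> set_comps A \<and> Min A \<in> hd P.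
     Poly_Mapping.single P ((- 1) ^ (length P - 1)))"

definition idempotent :: "'a::field fpi \<Rightarrow> bool" where
  "idempotent e \<longleftrightarrow> e \<noteq> 0 \<and> e \<curlywedge> e = e"

definition right_ideal :: "'a::field fpi \<Rightarrow> nat set \<Rightarrow> 'a fpi set" where
  "right_ideal e A = {e \<curlywedge> f | f. f \<in> FPi_comp A}"

end

theory Submission
  imports Defs
begin

text \<open>The coproduct and both products respect the grading of \<open>FPi\<close> by finite sets, so everything
  reduces to one degree \<open>A \<noteq> {}\<close>. There, \<open>f\<close> is primitive iff for every splitting of \<open>A\<close> into
  non-empty parts \<open>X\<close> and \<open>Y\<close> the component of the coproduct of \<open>f\<close> at \<open>(X, Y)\<close> vanishes
  (\<open>Prim_homogeneous_iff\<close>).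

  Left multiplication by a composition \<open>P\<close> with respect to \<open>\<curlywedge>\<close> restricts its argument to the blocks
  of \<open>P\<close> and concatenates the results. If \<open>P\<close> has at least two blocks, it therefore factors through
  a component of the coproduct and kills every primitive element, while the one-block composition
  acts as the identity. Hence \<open>g \<curlywedge> f = c f\<close> for primitive \<open>f\<close>, where \<open>c\<close> is the coefficient of the
  one-block composition in \<open>g\<close> (\<open>wedge_Prim_right\<close>). As restriction is multiplicative, \<open>f \<curlywedge> g\<close>
  is primitive whenever \<open>f\<close> is (\<open>wedge_Prim_left\<close>). So every primitive \<open>e\<close> with one-block
  coefficient 1 is an idempotent that generates the right ideal of all primitive elements of its
  degree. Such elements form an affine hyperplane not through 0 in this ideal, and so they span it.

  The element \<open>e_elem A\<close> is one of them (\<open>e_elem_Prim\<close>): the coefficients of its coproduct are sums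
  of signs over the quasi-shuffles of two compositions that have \<open>Min A\<close> in their first block. Such a
  quasi-shuffle starts with the block of \<open>Min A\<close> of one composition, either unchanged or
  united with the first block of the other composition, and these two kinds have opposite total signs.

  That the Lie product of primitive elements is primitive is the usual computation: only
  \<open>f \<otimes> g + g \<otimes> f\<close> survives in the mixed part of the coproduct of \<open>f \<curlyvee> g\<close>, and it is symmetric.

  For the dimension, fix \<open>a = Min A\<close>. A primitive element is determined by its coefficients at the
  compositions with \<open>a\<close> in the first block (\<open>Prim_eq_0_if_first_block_eq_0\<close>), and these
  coefficients can be prescribed arbitrarily: nested brackets of the elements \<open>e_elem p\<close>
  give a triangular system (\<open>Prim_leading_term\<close>). So the dimension is the number of such
  compositions, and deletion of \<open>a\<close> maps them two-to-one onto the compositions of \<open>A - {a}\<close>, unless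
  \<open>A = {a}\<close>.\<close>

section \<open>Set compositions, restriction and refinement\<close>

lemma set_comps_Nil [simp]: "[] \<in> set_comps A \<longleftrightarrow> A = {}"
  by (auto simp: set_comps_def disjoint_family_on_def)

text \<open>Membership in \<open>set_comps\<close> as a recursion over the list: this is what makes induction on the
  list of blocks possible, with the underlying set varying.\<close>

lemma set_comps_Cons [simp]:
  "p # P \<in> set_comps A \<longleftrightarrow> p \<noteq> {} \<and> p \<subseteq> A \<and> P \<in> set_comps (A - p)"
proof -
  have "disjoint_family_on ((!) (p # P)) {..<length (p # P)} \<longleftrightarrow>
      p \<inter> (\<Union>i\<in>{..<length P}. P ! i) = {} \<and> disjoint_family_on ((!) P) {..<length P}"
    by (simp add: lessThan_Suc_eq_insert_0 disjoint_family_on_insert image_image)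
       (simp add: disjoint_family_on_def)
  moreover have "(\<Union>i\<in>{..<length P}. P ! i) = \<Union>(set P)"
    by (simp add: set_conv_nth) blast
  ultimately show ?thesis
    unfolding set_comps_def mem_Collect_eq by auto
qed

lemma Union_set_comps: "P \<in> set_comps A \<Longrightarrow> \<Union>(set P) = A"
  by (simp add: set_comps_def)

lemma empty_notin_set_comps: "P \<in> set_comps A \<Longrightarrow> {} \<notin> set P"
  by (simp add: set_comps_def)

lemma set_comps_append [simp]:
  "P @ Q \<in> set_comps A \<longleftrightarrow>
     \<Union>(set P) \<subseteq> A \<and> P \<in> set_comps (\<Union>(set P)) \<and> Q \<in> set_comps (A - \<Union>(set P))"
proof (induction P arbitrary: A)
  case Nil
  then show ?case by simp
next
  case (Cons p P)
  have eq: "A - p - \<Union>(set P) = A - \<Union>(set (p # P))"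
    by auto
  have sets: "(p \<noteq> {} \<and> p \<subseteq> A \<and> U \<subseteq> A - p \<and> x \<and> y) \<longleftrightarrow>
      (p \<union> U \<subseteq> A \<and> (p \<noteq> {} \<and> p \<subseteq> p \<union> U \<and> x \<and> U \<inter> p = {}) \<and> y)" for U x y
    by blast
  have key: "P \<in> set_comps (\<Union>(set (p # P)) - p) \<longleftrightarrow>
      P \<in> set_comps (\<Union>(set P)) \<and> \<Union>(set P) \<inter> p = {}"
  proof (cases "\<Union>(set P) \<inter> p = {}")
    case True
    then have "\<Union>(set (p # P)) - p = \<Union>(set P)" by auto
    with True show ?thesis by simp
  next
    case False
    then show ?thesis
      using Union_set_comps[of P "\<Union>(set (p # P)) - p"] by blast
  qed
  have "(p # P) @ Q \<in> set_comps A \<longleftrightarrow> p \<noteq> {} \<and> p \<subseteq> A \<and> \<Union>(set P) \<subseteq> A - p \<and>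
      P \<in> set_comps (\<Union>(set P)) \<and> Q \<in> set_comps (A - \<Union>(set (p # P)))"
    by (simp only: append_Cons set_comps_Cons Cons.IH eq)
  also have "\<dots> \<longleftrightarrow> \<Union>(set (p # P)) \<subseteq> A \<and> (p \<noteq> {} \<and> p \<subseteq> \<Union>(set (p # P)) \<and>
      P \<in> set_comps (\<Union>(set P)) \<and> \<Union>(set P) \<inter> p = {}) \<and> Q \<in> set_comps (A - \<Union>(set (p # P)))"
    using sets[of "\<Union>(set P)"] by simp
  finally show ?case
    unfolding set_comps_Cons[of p P "\<Union>(set (p # P))"] key .
qed

lemma finite_set_comps: "finite A \<Longrightarrow> finite (set_comps A)"
proof (induction "card A" arbitrary: A rule: less_induct)
  case less
  have "set_comps A \<subseteq> {[]} \<union> (\<Union>p\<in>Pow A - {{}}. (#) p ` set_comps (A - p))"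
  proof
    fix P assume "P \<in> set_comps A"
    then show "P \<in> {[]} \<union> (\<Union>p\<in>Pow A - {{}}. (#) p ` set_comps (A - p))"
      by (cases P) auto
  qed
  moreover have "finite (set_comps (A - p))" if "p \<in> Pow A - {{}}" for p
    using less that by (intro less.hyps) (auto intro!: psubset_card_mono)
  ultimately show ?case
    using less.prems by (auto intro: finite_subset)
qed

lemma length_set_comps:
  assumes "P \<in> set_comps A" "finite A"
  shows "length P \<le> card A"
  using assms
proof (induction P arbitrary: A)
  case (Cons p P)
  then have "length P \<le> card (A - p)" by auto
  moreover have "card (A - p) < card A"
    using Cons.prems by (intro psubset_card_mono) auto
  ultimately show ?case by simp
qed simp

lemma restr_Nil [simp]: "restr [] X = []"
  by (simp add: restr_def)

lemma restr_Cons [simp]: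
  "restr (p # P) X = (if p \<inter> X = {} then restr P X else (p \<inter> X) # restr P X)"
  by (simp add: restr_def)

lemma restr_append [simp]: "restr (P @ Q) X = restr P X @ restr Q X"
  by (simp add: restr_def)

lemma restr_restr [simp]: "restr (restr P X) Y = restr P (X \<inter> Y)"
  by (induction P) (auto simp: Int_assoc)

lemma Union_restr [simp]: "\<Union>(set (restr P X)) = \<Union>(set P) \<inter> X"
  by (auto simp: restr_def)

lemma restr_eq_Nil: "restr P X = [] \<longleftrightarrow> \<Union>(set P) \<inter> X = {}"
  by (induction P) auto

lemma restr_ident: "{} \<notin> set P \<Longrightarrow> \<Union>(set P) \<subseteq> X \<Longrightarrow> restr P X = P"
  by (induction P) (auto simp: Int_absorb2)

lemma restr_set_comps_self: "P \<in> set_comps A \<Longrightarrow> A \<subseteq> X \<Longrightarrow> restr P X = P"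
  by (simp add: restr_ident Union_set_comps empty_notin_set_comps)

lemma restr_set_comps_disjoint: "P \<in> set_comps A \<Longrightarrow> A \<inter> X = {} \<Longrightarrow> restr P X = []"
  by (simp add: restr_eq_Nil Union_set_comps)

lemma restr_set_comps: "P \<in> set_comps A \<Longrightarrow> restr P X \<in> set_comps (A \<inter> X)"
proof (induction P arbitrary: A)
  case (Cons p P)
  then have "restr P X \<in> set_comps ((A - p) \<inter> X)" by auto
  moreover have "(A - p) \<inter> X = (A \<inter> X) - (p \<inter> X)" by auto
  moreover have "(A \<inter> X) - (p \<inter> X) = A \<inter> X" if "p \<inter> X = {}" using that by auto
  ultimately show ?case using Cons.prems by auto
qed simp

text \<open>The refinement of \<open>P\<close> by \<open>Q\<close>: the composition whose basis vector is the
  \<open>\<curlywedge>\<close>-product of the basis vectors of \<open>P\<close> and \<open>Q\<close>.\<close>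

definition refine :: "nat set list \<Rightarrow> nat set list \<Rightarrow> nat set list" where
  "refine P Q = filter (\<lambda>X. X \<noteq> {}) [X \<inter> Y. X \<leftarrow> P, Y \<leftarrow> Q]"

lemma refine_Nil [simp]: "refine [] Q = []"
  by (simp add: refine_def)

lemma refine_Cons [simp]: "refine (p # P) Q = restr Q p @ refine P Q"
  by (simp add: refine_def restr_def Int_commute[of p] cong: map_cong)

lemma restr_refine: "restr (refine P Q) X = refine (restr P X) (restr Q X)"
  by (induction P) (auto simp: Int_ac restr_eq_Nil)

lemma refine_restr: "\<Union>(set P) \<subseteq> X \<Longrightarrow> refine P (restr Q X) = refine P Q"
  by (induction P) (auto simp: Int_absorb1)

lemma refine_set_comps:
  "P \<in> set_comps A \<Longrightarrow> Q \<in> set_comps B \<Longrightarrow> A \<subseteq> B \<Longrightarrow> refine P Q \<in> set_comps A"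
proof (induction P arbitrary: A)
  case (Cons p P)
  have "restr Q p \<in> set_comps p"
    using restr_set_comps[OF Cons.prems(2), of p] Cons.prems
    by (metis Int_absorb1 order_trans set_comps_Cons)
  moreover have "refine P Q \<in> set_comps (A - p)"
    using Cons.prems by (intro Cons.IH) auto
  ultimately show ?case
    using Cons.prems by (auto simp: Union_set_comps Int_absorb1)
qed simp

section \<open>Evaluating linear extensions\<close>

text \<open>The value on \<open>f\<close> of the linear functional with value \<open>h P\<close> at the basis vector \<open>P\<close>.
  Equality in a free vector space is equality of all these values, and each of the operations
  is transposed by them into an operation on functions on the basis. So identities between
  products and coproducts become identities between iterated pairings.\<close>

definition pairing :: "('b \<Rightarrow>\<^sub>0 'a::field) \<Rightarrow> ('b \<Rightarrow> 'a) \<Rightarrow> 'a" where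
  "pairing f h = (\<Sum>P\<in>Poly_Mapping.keys f. Poly_Mapping.lookup f P * h P)"

lemma pairing_superset:
  "finite S \<Longrightarrow> Poly_Mapping.keys f \<subseteq> S \<Longrightarrow>
    pairing f h = (\<Sum>P\<in>S. Poly_Mapping.lookup f P * h P)"
  unfolding pairing_def by (rule sum.mono_neutral_left) (auto simp: in_keys_iff)

lemma pairing_0 [simp]: "pairing 0 h = 0"
  by (simp add: pairing_def)

lemma pairing_add [simp]: "pairing (f + g) h = pairing f h + pairing g h"
proof -
  let ?S = "Poly_Mapping.keys f \<union> Poly_Mapping.keys g"
  have "pairing (f + g) h = (\<Sum>P\<in>?S. Poly_Mapping.lookup (f + g) P * h P)"
    by (rule pairing_superset) (auto simp: in_keys_iff lookup_add)
  also have "\<dots> = pairing f h + pairing g h"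
    by (simp add: pairing_superset[of ?S] lookup_add distrib_right sum.distrib)
  finally show ?thesis .
qed

lemma pairing_fscale [simp]: "pairing (fscale c f) h = c * pairing f h"
proof -
  have "pairing (fscale c f) h =
      (\<Sum>P\<in>Poly_Mapping.keys f. Poly_Mapping.lookup (fscale c f) P * h P)"
    by (rule pairing_superset) (auto simp: in_keys_iff)
  also have "\<dots> = c * pairing f h"
    by (simp add: pairing_def sum_distrib_left mult.assoc)
  finally show ?thesis .
qed

lemma pairing_diff [simp]: "pairing (f - g) h = pairing f h - pairing g h"
proof -
  have "pairing (f - g) h + pairing g h = pairing f h"
    by (simp flip: pairing_add)
  then show ?thesis by (simp add: eq_diff_eq)
qed

lemma pairing_sum [simp]: "pairing (\<Sum>i\<in>I. f i) h = (\<Sum>i\<in>I. pairing (f i) h)"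
  by (induction I rule: infinite_finite_induct) auto

lemma pairing_single [simp]: "pairing (Poly_Mapping.single P c) h = c * h P"
  by (auto simp: pairing_def)

lemma pairing_cong:
  "(\<And>P. P \<in> Poly_Mapping.keys f \<Longrightarrow> h P = h' P) \<Longrightarrow> pairing f h = pairing f h'"
  by (simp add: pairing_def)

lemma pairing_zero_fun: "(\<And>P. P \<in> Poly_Mapping.keys f \<Longrightarrow> h P = 0) \<Longrightarrow> pairing f h = 0"
  by (simp add: pairing_def)

lemma pairing_fun_add: "pairing f (\<lambda>P. h P + h' P) = pairing f h + pairing f h'"
  by (simp add: pairing_def distrib_left sum.distrib)

lemma pairing_fun_sum: "pairing f (\<lambda>P. \<Sum>i\<in>I. h i P) = (\<Sum>i\<in>I. pairing f (h i))"
  unfolding pairing_def sum_distrib_left by (rule sum.swap)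

lemma pairing_swap:
  "pairing f (\<lambda>P. pairing g (\<lambda>Q. h P Q)) = pairing g (\<lambda>Q. pairing f (\<lambda>P. h P Q))"
  unfolding pairing_def sum_distrib_left by (subst sum.swap) (simp add: mult.left_commute)

lemma pairing_delta:
  "pairing f (\<lambda>Q. if Q = P then c else 0) = Poly_Mapping.lookup f P * c"
  by (auto simp: pairing_def if_distrib in_keys_iff cong: if_cong)

lemma lookup_eq_pairing:
  "Poly_Mapping.lookup f P = pairing f (\<lambda>Q. if Q = P then 1 else 0)"
  by (simp add: pairing_delta)

lemma pairing_eqI: "(\<And>h. pairing f h = pairing g h) \<Longrightarrow> f = g"
  by (rule poly_mapping_eqI) (simp add: lookup_eq_pairing)

lemma pairing_linear_ext: "pairing (linear_ext m f) h = pairing f (\<lambda>P. pairing (m P) h)"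
  by (simp add: linear_ext_def) (simp add: pairing_def)

lemma pairing_bilinear_ext:
  "pairing (bilinear_ext m f g) h = pairing f (\<lambda>P. pairing g (\<lambda>Q. pairing (m P Q) h))"
proof -
  have "pairing (bilinear_ext m f g) h = (\<Sum>P\<in>Poly_Mapping.keys f. \<Sum>Q\<in>Poly_Mapping.keys g.
      Poly_Mapping.lookup f P * (Poly_Mapping.lookup g Q * pairing (m P Q) h))"
    by (simp add: bilinear_ext_def mult.assoc)
  also have "\<dots> = pairing f (\<lambda>P. pairing g (\<lambda>Q. pairing (m P Q) h))"
    by (simp add: pairing_def[of f] pairing_def[of g] sum_distrib_left)
  finally show ?thesis .
qed

lemma pairing_tensor:
  "pairing (f \<otimes> g) h = pairing f (\<lambda>P. pairing g (\<lambda>Q. h (P, Q)))"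
  by (simp add: tensor_def pairing_bilinear_ext)

lemma pairing_coprod:
  "pairing (coprod f) h =
     pairing f (\<lambda>P. \<Sum>X\<in>Pow (\<Union>(set P)). h (restr P X, restr P (\<Union>(set P) - X)))"
  by (simp add: coprod_def pairing_linear_ext pairing_tensor)

lemma FPi_comp_keysD: "f \<in> FPi_comp A \<Longrightarrow> P \<in> Poly_Mapping.keys f \<Longrightarrow> P \<in> set_comps A"
  by (auto simp: FPi_comp_def)

lemma FPi_comp_Union:
  "f \<in> FPi_comp A \<Longrightarrow> P \<in> Poly_Mapping.keys f \<Longrightarrow> \<Union>(set P) = A"
  by (rule Union_set_comps) (rule FPi_comp_keysD)

lemma pairing_wedge:
  assumes "f \<in> FPi_comp A" "g \<in> FPi_comp A"
  shows "pairing (f \<curlywedge> g) h = pairing f (\<lambda>P. pairing g (\<lambda>Q. h (refine P Q)))"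
proof -
  have "pairing (basis_wedge P Q) h = h (refine P Q)"
    if "P \<in> Poly_Mapping.keys f" "Q \<in> Poly_Mapping.keys g" for P Q
    using FPi_comp_Union[OF assms(1) that(1)] FPi_comp_Union[OF assms(2) that(2)]
    by (simp add: basis_wedge_def refine_def)
  then show ?thesis
    unfolding wedge_def pairing_bilinear_ext by (simp cong: pairing_cong)
qed

lemma pairing_vee:
  "pairing (f \<curlyvee> g) h = pairing f (\<lambda>P. pairing g (\<lambda>Q.
     if \<Union>(set P) \<inter> \<Union>(set Q) = {} then h (P @ Q) else 0))"
  by (simp add: vee_def pairing_bilinear_ext basis_vee_def if_distrib[where f = "\<lambda>x. pairing x h"]
      cong: if_cong)

lemma pairing_vee_disjoint:
  assumes "f \<in> FPi_comp A" "g \<in> FPi_comp B" "A \<inter> B = {}"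
  shows "pairing (f \<curlyvee> g) h = pairing f (\<lambda>P. pairing g (\<lambda>Q. h (P @ Q)))"
  using assms(3)
  by (simp add: pairing_vee FPi_comp_Union[OF assms(1)] FPi_comp_Union[OF assms(2)]
      cong: pairing_cong)

lemma lie_prod_add_left: "lie_prod (f + g) k = lie_prod f k + lie_prod g k"
  by (rule pairing_eqI) (simp add: lie_prod_def pairing_vee pairing_fun_add)

lemma lie_prod_add_right: "lie_prod k (f + g) = lie_prod k f + lie_prod k g"
  by (rule pairing_eqI) (simp add: lie_prod_def pairing_vee pairing_fun_add)

lemma lie_prod_0 [simp]: "lie_prod 0 f = 0" "lie_prod f 0 = 0"
  by (rule pairing_eqI, simp add: lie_prod_def pairing_vee pairing_zero_fun)+

lemma lie_prod_sum_left: "lie_prod (\<Sum>i\<in>I. f i) k = (\<Sum>i\<in>I. lie_prod (f i) k)"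
  by (induction I rule: infinite_finite_induct) (auto simp: lie_prod_add_left)

lemma lie_prod_sum_right: "lie_prod k (\<Sum>i\<in>I. f i) = (\<Sum>i\<in>I. lie_prod k (f i))"
  by (induction I rule: infinite_finite_induct) (auto simp: lie_prod_add_right)

lemma FPi_comp_subspace: "free_vs.subspace (FPi_comp A :: 'a::field fpi set)"
  unfolding free_vs.subspace_def FPi_comp_def
  by (auto simp: in_keys_iff lookup_add subset_iff) (metis add.right_neutral)

lemma FPi_subspace: "free_vs.subspace (FPi :: 'a::field fpi set)"
  unfolding free_vs.subspace_def FPi_def
  by (auto simp: in_keys_iff lookup_add subset_iff) (metis add.right_neutral)

lemma FPi_comp_subset_FPi: "A \<in> fin_subsets \<Longrightarrow> FPi_comp A \<subseteq> FPi"
  by (auto simp: FPi_comp_def FPi_def)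

text \<open>A vector lies in a coordinate subspace once it is annihilated by the functionals that
  vanish on that subspace.\<close>

lemma keys_subsetI:
  assumes "\<And>h. (\<And>P. P \<in> S \<Longrightarrow> h P = 0) \<Longrightarrow> pairing f h = 0"
  shows "Poly_Mapping.keys f \<subseteq> S"
proof
  fix P assume P: "P \<in> Poly_Mapping.keys f"
  show "P \<in> S"
  proof (rule ccontr)
    assume "P \<notin> S"
    then have "Poly_Mapping.lookup f P = 0"
      unfolding lookup_eq_pairing by (intro assms) auto
    with P show False by (simp add: in_keys_iff)
  qed
qed

lemma wedge_in_FPi_comp:
  assumes "f \<in> FPi_comp A" "g \<in> FPi_comp A"
  shows "f \<curlywedge> g \<in> FPi_comp A"
  unfolding FPi_comp_def mem_Collect_eq
proof (rule keys_subsetI)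
  fix h :: "nat set list \<Rightarrow> 'a"
  assume h: "\<And>P. P \<in> set_comps A \<Longrightarrow> h P = 0"
  show "pairing (f \<curlywedge> g) h = 0"
    unfolding pairing_wedge[OF assms]
    by (intro pairing_zero_fun h refine_set_comps[where B = A])
       (auto intro: FPi_comp_keysD[OF assms(1)] FPi_comp_keysD[OF assms(2)])
qed

lemma vee_in_FPi_comp:
  assumes "f \<in> FPi_comp A" "g \<in> FPi_comp B" "A \<inter> B = {}"
  shows "f \<curlyvee> g \<in> FPi_comp (A \<union> B)"
  unfolding FPi_comp_def mem_Collect_eq
proof (rule keys_subsetI)
  fix h :: "nat set list \<Rightarrow> 'a"
  assume h: "\<And>P. P \<in> set_comps (A \<union> B) \<Longrightarrow> h P = 0"
  have "P @ Q \<in> set_comps (A \<union> B)"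
    if "P \<in> Poly_Mapping.keys f" "Q \<in> Poly_Mapping.keys g" for P Q
    using FPi_comp_keysD[OF assms(1) that(1)] FPi_comp_keysD[OF assms(2) that(2)] assms(3)
    by (auto simp: Union_set_comps Un_Diff Diff_triv Int_commute)
  then show "pairing (f \<curlyvee> g) h = 0"
    unfolding pairing_vee_disjoint[OF assms] by (intro pairing_zero_fun h) auto
qed

lemma lie_prod_in_FPi_comp:
  assumes "f \<in> FPi_comp A" "g \<in> FPi_comp B" "A \<inter> B = {}"
  shows "lie_prod f g \<in> FPi_comp (A \<union> B)"
  unfolding lie_prod_def
  using vee_in_FPi_comp[OF assms] vee_in_FPi_comp[OF assms(2,1)] assms(3)
  by (intro free_vs.subspace_diff FPi_comp_subspace) (auto simp: Un_commute Int_commute)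

lemma lie_prod_not_disjoint:
  assumes "f \<in> FPi_comp A" "g \<in> FPi_comp B" "A \<inter> B \<noteq> {}"
  shows "lie_prod f g = 0"
proof (rule pairing_eqI)
  fix h
  show "pairing (lie_prod f g) h = pairing 0 h"
    using assms(3) Int_commute[of A B] unfolding lie_prod_def pairing_diff pairing_vee
    by (simp add: FPi_comp_Union[OF assms(1)] FPi_comp_Union[OF assms(2)]
        pairing_zero_fun cong: pairing_cong)
qed

section \<open>Primitivity in one degree\<close>

text \<open>In degree \<open>A\<close> the coproduct splits into components indexed by the subsets \<open>X\<close> of \<open>A\<close>.
  Those for \<open>X = {}\<close> and \<open>X = A\<close> are the two terms \<open>1 \<otimes> f\<close> and \<open>f \<otimes> 1\<close> of the primitivity
  equation, so \<open>f\<close> is primitive iff the component at every non-empty proper subset \<open>X\<close>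
  vanishes, that is, iff every function of the two restrictions pairs to zero with \<open>f\<close>.\<close>

lemma pairing_coprod_homogeneous:
  assumes A: "finite A" "A \<noteq> {}" and f: "f \<in> FPi_comp A"
  shows "pairing (coprod f) h =
    pairing (f \<otimes> empty_comp + empty_comp \<otimes> f) h +
    (\<Sum>X\<in>Pow A - {{}, A}. pairing f (\<lambda>P. h (restr P X, restr P (A - X))))"
proof -
  have split: "(\<Sum>X\<in>Pow A. h (restr P X, restr P (A - X))) = h (P, []) + h ([], P) +
      (\<Sum>X\<in>Pow A - {{}, A}. h (restr P X, restr P (A - X)))" if "P \<in> set_comps A" for P
  proof -
    have "Pow A = insert {} (insert A (Pow A - {{}, A}))" by auto
    then have "(\<Sum>X\<in>Pow A. h (restr P X, restr P (A - X))) =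
        (\<Sum>X\<in>insert {} (insert A (Pow A - {{}, A})). h (restr P X, restr P (A - X)))"
      by simp
    also have "\<dots> = h (restr P {}, restr P A) + (h (restr P A, restr P {}) +
        (\<Sum>X\<in>Pow A - {{}, A}. h (restr P X, restr P (A - X))))"
      using A by (subst sum.insert, simp, simp, subst sum.insert) auto
    finally show ?thesis
      using that by (simp add: restr_set_comps_self restr_set_comps_disjoint add_ac)
  qed
  have "pairing (coprod f) h = pairing f (\<lambda>P. h (P, []) + h ([], P) +
      (\<Sum>X\<in>Pow A - {{}, A}. h (restr P X, restr P (A - X))))"
    unfolding pairing_coprod
    by (rule pairing_cong) (simp only: FPi_comp_Union[OF f] split[OF FPi_comp_keysD[OF f]])
  then show ?thesis
    by (simp add: pairing_fun_add pairing_fun_sum pairing_tensor empty_comp_def)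
qed

lemma Prim_homogeneous_iff:
  assumes A: "A \<in> fin_subsets" "A \<noteq> {}" and f: "f \<in> FPi_comp A"
  shows "f \<in> Prim \<longleftrightarrow> (\<forall>X Y \<phi>. X \<noteq> {} \<longrightarrow> Y \<noteq> {} \<longrightarrow> X \<inter> Y = {} \<longrightarrow> X \<union> Y = A \<longrightarrow>
    pairing f (\<lambda>P. \<phi> (restr P X) (restr P Y)) = 0)"
proof -
  have fin: "finite A" using A by (simp add: fin_subsets_def)
  note cop = pairing_coprod_homogeneous[OF fin A(2) f]
  show ?thesis
  proof (intro iffI allI impI)
    fix X Y and \<phi> :: "nat set list \<Rightarrow> nat set list \<Rightarrow> 'a"
    assume prim: "f \<in> Prim" and X: "X \<noteq> {}" and Y: "Y \<noteq> {}" "X \<inter> Y = {}" "X \<union> Y = A"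
    \<comment> \<open>A test function that sees only the component of the coproduct at \<open>X\<close>.\<close>
    define h where "h = (\<lambda>(u, v). if \<Union>(set u) = X then \<phi> u v else 0)"
    have "(\<Sum>Z\<in>Pow A - {{}, A}. pairing f (\<lambda>P. h (restr P Z, restr P (A - Z)))) = 0"
      using cop[of h] prim by (simp add: Prim_def)
    moreover have "(\<Sum>Z\<in>Pow A - {{}, A}. pairing f (\<lambda>P. h (restr P Z, restr P (A - Z)))) =
        (\<Sum>Z\<in>Pow A - {{}, A}. if Z = X then pairing f (\<lambda>P. \<phi> (restr P X) (restr P Y)) else 0)"
    proof (rule sum.cong[OF refl])
      fix Z assume Z: "Z \<in> Pow A - {{}, A}"
      have "A - X = Y" using Y by auto
      moreover have "\<Union>(set (restr P Z)) = Z" if "P \<in> Poly_Mapping.keys f" for P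
        using Z FPi_comp_Union[OF f that] by (simp add: Int_absorb1)
      ultimately show "pairing f (\<lambda>P. h (restr P Z, restr P (A - Z))) =
          (if Z = X then pairing f (\<lambda>P. \<phi> (restr P X) (restr P Y)) else 0)"
        by (cases "Z = X") (simp_all add: h_def pairing_zero_fun del: Union_restr cong: pairing_cong)
    qed
    moreover have "X \<in> Pow A - {{}, A}" using X Y by auto
    ultimately show "pairing f (\<lambda>P. \<phi> (restr P X) (restr P Y)) = 0"
      using fin by (simp add: sum.delta)
  next
    assume null: "\<forall>X Y \<phi>. X \<noteq> {} \<longrightarrow> Y \<noteq> {} \<longrightarrow> X \<inter> Y = {} \<longrightarrow> X \<union> Y = A \<longrightarrow>
      pairing f (\<lambda>P. \<phi> (restr P X) (restr P Y)) = 0"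
    have "pairing f (\<lambda>P. h (restr P X, restr P (A - X))) = 0"
      if "X \<in> Pow A - {{}, A}" for X and h :: "nat set list \<times> nat set list \<Rightarrow> 'a"
      using null[rule_format, of X "A - X" "\<lambda>u v. h (u, v)"] that by auto
    then have "coprod f = f \<otimes> empty_comp + empty_comp \<otimes> f"
      by (intro pairing_eqI) (simp only: cop, simp)
    with f A FPi_comp_subset_FPi show "f \<in> Prim"
      by (auto simp: Prim_def)
  qed
qed

lemma Prim_pairing_eq_0:
  assumes "f \<in> Prim" "A \<in> fin_subsets" "f \<in> FPi_comp A"
    and "X \<noteq> {}" "Y \<noteq> {}" "X \<inter> Y = {}" "X \<union> Y = A"
  shows "pairing f (\<lambda>P. \<phi> (restr P X) (restr P Y)) = 0"
  using assms Prim_homogeneous_iff[of A f] by auto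

lemma Prim_subspace: "free_vs.subspace (Prim :: 'a::field fpi set)"
proof -
  have "coprod (0 :: 'a fpi) = 0 \<otimes> empty_comp + empty_comp \<otimes> 0"
    by (rule pairing_eqI) (simp add: pairing_coprod pairing_tensor empty_comp_def)
  moreover have "coprod (f + g) = (f + g) \<otimes> empty_comp + empty_comp \<otimes> (f + g)"
    if fg: "coprod f = f \<otimes> empty_comp + empty_comp \<otimes> f"
      "coprod g = g \<otimes> empty_comp + empty_comp \<otimes> g" for f g :: "'a fpi"
  proof (rule pairing_eqI)
    fix h
    have "pairing (coprod (f + g)) h = pairing (coprod f) h + pairing (coprod g) h"
      by (simp add: pairing_coprod)
    then show "pairing (coprod (f + g)) h =
        pairing ((f + g) \<otimes> empty_comp + empty_comp \<otimes> (f + g)) h"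
      unfolding fg by (simp add: pairing_tensor empty_comp_def)
  qed
  moreover have "coprod (fscale c f) = fscale c f \<otimes> empty_comp + empty_comp \<otimes> fscale c f"
    if f: "coprod f = f \<otimes> empty_comp + empty_comp \<otimes> f" for c and f :: "'a fpi"
  proof (rule pairing_eqI)
    fix h
    have "pairing (coprod (fscale c f)) h = c * pairing (coprod f) h"
      by (simp add: pairing_coprod)
    then show "pairing (coprod (fscale c f)) h =
        pairing (fscale c f \<otimes> empty_comp + empty_comp \<otimes> fscale c f) h"
      unfolding f by (simp add: pairing_tensor empty_comp_def distrib_left)
  qed
  ultimately show ?thesis
    using FPi_subspace unfolding free_vs.subspace_def Prim_def by auto
qed

section \<open>Homogeneous components\<close>

definition component :: "nat set \<Rightarrow> 'a::field fpi \<Rightarrow> 'a fpi" where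
  "component A = linear_ext (\<lambda>P. if \<Union>(set P) = A then Poly_Mapping.single P 1 else 0)"

lemma pairing_component:
  "pairing (component A f) h = pairing f (\<lambda>P. if \<Union>(set P) = A then h P else 0)"
  by (simp add: component_def pairing_linear_ext if_distrib[where f = "\<lambda>x. pairing x h"] cong: if_cong)

lemma lookup_component:
  "Poly_Mapping.lookup (component A f) P =
    (if \<Union>(set P) = A then Poly_Mapping.lookup f P else 0)"
proof -
  have "Poly_Mapping.lookup (component A f) P =
      pairing f (\<lambda>Q. if Q = P then (if \<Union>(set P) = A then 1 else 0) else 0)"
    unfolding lookup_eq_pairing pairing_component by (rule pairing_cong) auto
  then show ?thesis by (simp add: pairing_delta)
qed

lemma component_in_FPi_comp:
  assumes "f \<in> FPi" shows "component A f \<in> FPi_comp A"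
  using assms by (auto simp: FPi_def FPi_comp_def in_keys_iff lookup_component subset_iff
    split: if_splits dest: Union_set_comps)

lemma component_self: "f \<in> FPi_comp A \<Longrightarrow> component A f = f"
  by (rule poly_mapping_eqI) (auto simp: lookup_component in_keys_iff dest: FPi_comp_Union)

lemma component_other: "f \<in> FPi_comp A \<Longrightarrow> A \<noteq> B \<Longrightarrow> component B f = 0"
  by (rule poly_mapping_eqI) (auto simp: lookup_component in_keys_iff dest: FPi_comp_Union)

lemma component_sum: "component A (\<Sum>i\<in>I. f i) = (\<Sum>i\<in>I. component A (f i))"
  by (rule pairing_eqI) (simp add: pairing_component)

lemma sum_components:
  assumes "f \<in> FPi"
  obtains J where "finite J" "J \<subseteq> fin_subsets" "f = (\<Sum>A\<in>J. component A f)"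
proof
  let ?J = "(\<lambda>P. \<Union>(set P)) ` Poly_Mapping.keys f"
  show "finite ?J" by simp
  show "?J \<subseteq> fin_subsets"
    using assms by (auto simp: FPi_def dest!: Union_set_comps)
  show "f = (\<Sum>A\<in>?J. component A f)"
    by (rule poly_mapping_eqI) (auto simp: lookup_sum lookup_component in_keys_iff)
qed

text \<open>The coproduct of a composition of \<open>A\<close> involves only pairs whose blocks together cover \<open>A\<close>.
  So the degree \<open>A\<close> part of the primitivity equation is the equation for the component.\<close>

lemma component_Prim:
  assumes "f \<in> Prim" "A \<in> fin_subsets"
  shows "component A (f :: 'a::field fpi) \<in> Prim"
proof -
  have "coprod (component A f) =
      component A f \<otimes> empty_comp + empty_comp \<otimes> component A f"
  proof (rule pairing_eqI)
    fix h :: "nat set list \<times> nat set list \<Rightarrow> 'a"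
    define k where "k = (\<lambda>(u, v). if \<Union>(set u) \<union> \<Union>(set v) = A then h (u, v) else 0)"
    have *: "(\<Sum>X\<in>Pow (\<Union>(set P)). k (restr P X, restr P (\<Union>(set P) - X))) =
        (if \<Union>(set P) = A
         then \<Sum>X\<in>Pow (\<Union>(set P)). h (restr P X, restr P (\<Union>(set P) - X)) else 0)" for P
    proof -
      have "\<Union>(set P) \<inter> X \<union> \<Union>(set P) \<inter> (\<Union>(set P) - X) = \<Union>(set P)" for X
        by blast
      then show ?thesis by (simp add: k_def)
    qed
    have "pairing (coprod (component A f)) h = pairing (coprod f) k"
      by (simp only: pairing_coprod pairing_component *)
    also have "\<dots> = pairing (f \<otimes> empty_comp + empty_comp \<otimes> f) k"
      using assms by (simp add: Prim_def)
    also have "\<dots> = pairing (component A f \<otimes> empty_comp + empty_comp \<otimes> component A f) h"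
      by (simp add: pairing_tensor pairing_component empty_comp_def k_def)
    finally show "pairing (coprod (component A f)) h =
      pairing (component A f \<otimes> empty_comp + empty_comp \<otimes> component A f) h" .
  qed
  moreover have "component A f \<in> FPi"
    using component_in_FPi_comp[of f A] FPi_comp_subset_FPi[OF assms(2)] assms(1)
    by (auto simp: Prim_def)
  ultimately show ?thesis by (simp add: Prim_def)
qed

text \<open>A multiple \<open>c \<emptyset>\<close> of the empty composition has coproduct \<open>c (\<emptyset> \<otimes> \<emptyset>)\<close>, which is to
  equal \<open>2 c (\<emptyset> \<otimes> \<emptyset>)\<close>.\<close>

lemma component_empty_Prim:
  assumes "(f :: 'a::field fpi) \<in> Prim" shows "component {} f = 0"
proof -
  \<comment> \<open>Also in characteristic 2, so \<open>c = 2 c\<close> always gives \<open>c = 0\<close>.\<close>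
  have two: "(2 :: 'a) \<noteq> 1"
    by (metis add_cancel_right_right one_add_one one_neq_zero)
  let ?g = "component {} f"
  have g: "?g \<in> Prim" "?g \<in> FPi_comp {}"
    using assms component_Prim[OF assms, of "{}"] component_in_FPi_comp[of f "{}"]
    by (auto simp: fin_subsets_def Prim_def)
  have keys: "P = []" if "P \<in> Poly_Mapping.keys ?g" for P
    using FPi_comp_keysD[OF g(2) that] by (cases P) auto
  then have pair: "pairing ?g h = Poly_Mapping.lookup ?g [] * h []" for h
    by (subst pairing_superset[where S = "{[]}"]) auto
  have "pairing (coprod ?g) (\<lambda>_. 1) = pairing (?g \<otimes> empty_comp + empty_comp \<otimes> ?g) (\<lambda>_. 1)"
    using g by (simp add: Prim_def)
  then have "Poly_Mapping.lookup ?g [] = 0"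
    by (simp add: pairing_coprod pairing_tensor empty_comp_def pair two)
  then show ?thesis
    using keys by (metis in_keys_iff lookup_zero poly_mapping_eqI)
qed

section \<open>Primitive elements and the product \<open>\<curlywedge>\<close>\<close>

text \<open>If \<open>P = p # P'\<close> has a second block then \<open>refine P Q\<close> depends only on the restrictions
  of \<open>Q\<close> to \<open>p\<close> and to its complement, so a primitive element is annihilated.\<close>

lemma Prim_pairing_refine_eq_0:
  assumes f: "f \<in> Prim" "A \<in> fin_subsets" "f \<in> FPi_comp A"
    and P: "P \<in> set_comps A" "2 \<le> length P"
  shows "pairing f (\<lambda>Q. h (refine P Q)) = 0"
proof -
  obtain p P' where PP: "P = p # P'" "P' \<noteq> []"
    using P(2) by (cases P) (auto simp: Suc_le_eq)
  have p: "p \<noteq> {}" "p \<subseteq> A" "P' \<in> set_comps (A - p)"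
    using P PP by auto
  have "A - p \<noteq> {}"
    using p(3) PP(2) by (cases P') auto
  moreover have "refine P Q = restr Q p @ refine P' (restr Q (A - p))" for Q
    using p by (simp add: PP refine_restr Union_set_comps)
  ultimately show ?thesis
    using Prim_pairing_eq_0[OF f, of p "A - p" "\<lambda>u v. h (u @ refine P' v)"] p by auto
qed

text \<open>Hence left multiplication by \<open>g\<close> acts on the primitive elements of degree \<open>A\<close> as a scalar,
  namely the coefficient of the one-block composition in \<open>g\<close>.\<close>

lemma wedge_Prim_right:
  assumes f: "f \<in> Prim" "A \<in> fin_subsets" "A \<noteq> {}" "f \<in> FPi_comp A" and g: "g \<in> FPi_comp A"
  shows "g \<curlywedge> f = fscale (Poly_Mapping.lookup g [A]) f"
proof (rule pairing_eqI)
  fix h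
  have "pairing f (\<lambda>Q. h (refine P Q)) = (if P = [A] then pairing f h else 0)"
    if "P \<in> Poly_Mapping.keys g" for P
  proof (cases "P = [A]")
    case True
    then show ?thesis
      using FPi_comp_keysD[OF f(4)]
      by (auto simp: restr_set_comps_self[OF _ order_refl] intro!: pairing_cong)
  next
    case False
    have P: "P \<in> set_comps A" using g that by (rule FPi_comp_keysD)
    have "P \<noteq> []" using P f(3) by auto
    with False P have "2 \<le> length P"
      by (cases P; cases "tl P") (auto simp: Diff_eq_empty_iff)
    with False show ?thesis
      using Prim_pairing_refine_eq_0[OF f(1,2,4) P] by simp
  qed
  then show "pairing (g \<curlywedge> f) h = pairing (fscale (Poly_Mapping.lookup g [A]) f) h"
    unfolding pairing_wedge[OF g f(4)] by (simp add: pairing_delta cong: pairing_cong)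
qed

text \<open>Restriction is compatible with refinement, so the restrictions of a product
  \<open>refine P Q\<close> are functions of the restrictions of \<open>P\<close>, for each fixed \<open>Q\<close>, and
  the primitivity of \<open>f\<close> applies to them.\<close>

lemma wedge_Prim_left:
  assumes f: "f \<in> Prim" "A \<in> fin_subsets" "A \<noteq> {}" "f \<in> FPi_comp A" and g: "g \<in> FPi_comp A"
  shows "f \<curlywedge> g \<in> Prim"
  unfolding Prim_homogeneous_iff[OF f(2,3) wedge_in_FPi_comp[OF f(4) g]]
proof (intro allI impI)
  fix X Y and \<phi> :: "nat set list \<Rightarrow> nat set list \<Rightarrow> 'a"
  assume XY: "X \<noteq> {}" "Y \<noteq> {}" "X \<inter> Y = {}" "X \<union> Y = A"
  have "pairing (f \<curlywedge> g) (\<lambda>P. \<phi> (restr P X) (restr P Y)) = pairing g (\<lambda>Q. pairing f (\<lambda>P.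
      \<phi> (refine (restr P X) (restr Q X)) (refine (restr P Y) (restr Q Y))))"
    by (simp add: pairing_wedge[OF f(4) g] restr_refine pairing_swap[of f])
  also have "\<dots> = 0"
    by (rule pairing_zero_fun, rule Prim_pairing_eq_0[OF f(1,2,4) XY])
  finally show "pairing (f \<curlywedge> g) (\<lambda>P. \<phi> (restr P X) (restr P Y)) = 0" .
qed

section \<open>The Lie product of primitive elements\<close>

text \<open>In the coproduct of \<open>f \<curlyvee> g\<close> at \<open>(X, Y)\<close>, every term is killed by the primitivity of \<open>f\<close> or
  \<open>g\<close> unless neither \<open>A\<close> nor \<open>B\<close> is cut, so only \<open>f \<otimes> g\<close> and \<open>g \<otimes> f\<close> survive. Their sum
  is symmetric in \<open>f\<close> and \<open>g\<close>.\<close>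

lemma pairing_vee_Prim:
  assumes f: "f \<in> Prim" "A \<in> fin_subsets" "A \<noteq> {}" "f \<in> FPi_comp A"
    and g: "g \<in> Prim" "B \<in> fin_subsets" "B \<noteq> {}" "g \<in> FPi_comp B" and AB: "A \<inter> B = {}"
    and XY: "X \<noteq> {}" "Y \<noteq> {}" "X \<inter> Y = {}" "X \<union> Y = A \<union> B"
  shows "pairing (f \<curlyvee> g) (\<lambda>P. \<phi> (restr P X) (restr P Y)) =
    pairing f (\<lambda>P. pairing g (\<lambda>Q.
      if X = A then \<phi> P Q else if X = B then \<phi> Q P else 0))"
proof -
  have fX: "restr P X = restr P (A \<inter> X)" "restr P Y = restr P (A \<inter> Y)"
    if "P \<in> Poly_Mapping.keys f" for P
    using restr_restr[of P A] restr_set_comps_self[OF FPi_comp_keysD[OF f(4) that]] by auto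
  have gX: "restr Q X = restr Q (B \<inter> X)" "restr Q Y = restr Q (B \<inter> Y)"
    if "Q \<in> Poly_Mapping.keys g" for Q
    using restr_restr[of Q B] restr_set_comps_self[OF FPi_comp_keysD[OF g(4) that]] by auto
  have expand: "pairing (f \<curlyvee> g) (\<lambda>P. \<phi> (restr P X) (restr P Y)) = pairing f (\<lambda>P. pairing g (\<lambda>Q.
      \<phi> (restr P (A \<inter> X) @ restr Q (B \<inter> X)) (restr P (A \<inter> Y) @ restr Q (B \<inter> Y))))"
    unfolding pairing_vee_disjoint[OF f(4) g(4) AB] restr_append
    by (intro pairing_cong) (simp only: fX gX)
  have parts: "X = (A \<inter> X) \<union> (B \<inter> X)" "Y = (A \<inter> Y) \<union> (B \<inter> Y)"
    "A = (A \<inter> X) \<union> (A \<inter> Y)" "B = (B \<inter> X) \<union> (B \<inter> Y)"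
    by (simp_all flip: Int_Un_distrib Int_Un_distrib2 add: XY(4)[symmetric])
       (simp_all add: XY(4))
  consider "A \<inter> X \<noteq> {}" "A \<inter> Y \<noteq> {}" | "B \<inter> X \<noteq> {}" "B \<inter> Y \<noteq> {}" | "X = A" "Y = B" | "X = B" "Y = A"
    using parts XY(1,2) by (metis sup_bot.left_neutral sup_bot.right_neutral)
  then show ?thesis
  proof cases
    case 1
    have "pairing f (\<lambda>P. \<phi> (restr P (A \<inter> X) @ u) (restr P (A \<inter> Y) @ v)) = 0" for u v
      using XY 1 by (intro Prim_pairing_eq_0[OF f(1,2,4), where \<phi> = "\<lambda>a b. \<phi> (a @ u) (b @ v)"]) auto
    moreover have "X \<noteq> A" "X \<noteq> B" using 1 XY AB by auto
    ultimately show ?thesis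
      unfolding expand pairing_swap[of f] by (simp add: pairing_zero_fun)
  next
    case 2
    have "pairing g (\<lambda>Q. \<phi> (u @ restr Q (B \<inter> X)) (v @ restr Q (B \<inter> Y))) = 0" for u v
      using XY 2 by (intro Prim_pairing_eq_0[OF g(1,2,4), where \<phi> = "\<lambda>a b. \<phi> (u @ a) (v @ b)"]) auto
    moreover have "X \<noteq> A" "X \<noteq> B" using 2 XY AB by auto
    ultimately show ?thesis
      unfolding expand by (simp add: pairing_zero_fun)
  next
    case 3
    show ?thesis
      unfolding expand using 3 AB
      by (intro pairing_cong) (auto dest!: FPi_comp_keysD[OF f(4)] FPi_comp_keysD[OF g(4)]
        simp: restr_set_comps_self restr_set_comps_disjoint Int_commute)
  next
    case 4
    have "X \<noteq> A" using 4 AB f(3) by auto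
    then show ?thesis
      unfolding expand using 4 AB
      by (intro pairing_cong) (auto dest!: FPi_comp_keysD[OF f(4)] FPi_comp_keysD[OF g(4)]
        simp: restr_set_comps_self restr_set_comps_disjoint Int_commute)
  qed
qed

lemma lie_prod_Prim_homogeneous:
  assumes f: "f \<in> Prim" "A \<in> fin_subsets" "A \<noteq> {}" "f \<in> FPi_comp A"
    and g: "g \<in> Prim" "B \<in> fin_subsets" "B \<noteq> {}" "g \<in> FPi_comp B"
  shows "lie_prod f g \<in> Prim"
proof (cases "A \<inter> B = {}")
  case False
  then show ?thesis
    using lie_prod_not_disjoint[OF f(4) g(4)] free_vs.subspace_0[OF Prim_subspace] by simp
next
  case True
  have AB: "A \<union> B \<in> fin_subsets" "A \<union> B \<noteq> {}"
    using f g by (auto simp: fin_subsets_def)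
  show ?thesis
    unfolding Prim_homogeneous_iff[OF AB lie_prod_in_FPi_comp[OF f(4) g(4) True]]
  proof (intro allI impI)
    fix X Y and \<phi> :: "nat set list \<Rightarrow> nat set list \<Rightarrow> 'a"
    assume XY: "X \<noteq> {}" "Y \<noteq> {}" "X \<inter> Y = {}" "X \<union> Y = A \<union> B"
    have "A \<noteq> B" using True f(3) by auto
    have "pairing (g \<curlyvee> f) (\<lambda>P. \<phi> (restr P X) (restr P Y)) =
        pairing f (\<lambda>P. pairing g (\<lambda>Q. if X = B then \<phi> Q P else if X = A then \<phi> P Q else 0))"
      using True XY by (subst pairing_vee_Prim[OF g f]) (auto intro: pairing_swap)
    then show "pairing (lie_prod f g) (\<lambda>P. \<phi> (restr P X) (restr P Y)) = 0"
      unfolding lie_prod_def pairing_diff pairing_vee_Prim[OF f g True XY]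
      using \<open>A \<noteq> B\<close> by (cases "X = A") (simp_all cong: if_cong)
  qed
qed

lemma Prim_decompose:
  assumes "f \<in> Prim"
  obtains J where "finite J" "J \<subseteq> fin_subsets - {{}}" "f = (\<Sum>A\<in>J. component A f)"
    and "\<And>A. A \<in> J \<Longrightarrow> component A f \<in> Prim \<inter> FPi_comp A"
proof -
  obtain J where J: "finite J" "J \<subseteq> fin_subsets" "f = (\<Sum>A\<in>J. component A f)"
    using sum_components[of f] assms by (auto simp: Prim_def)
  show thesis
  proof
    show "finite (J - {{}})" "J - {{}} \<subseteq> fin_subsets - {{}}" using J by auto
    have "(\<Sum>A\<in>J. component A f) = (\<Sum>A\<in>J - {{}}. component A f)"
      using J component_empty_Prim[OF assms] by (intro sum.mono_neutral_right) auto
    with J(3) show "f = (\<Sum>A\<in>J - {{}}. component A f)" by simp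
    show "component A f \<in> Prim \<inter> FPi_comp A" if "A \<in> J - {{}}" for A
      using that J component_Prim[OF assms] component_in_FPi_comp assms by (auto simp: Prim_def)
  qed
qed

lemma lie_subalgebra_Prim: "lie_subalgebra (Prim :: 'a::field fpi set)"
  unfolding lie_subalgebra_def
proof (intro conjI ballI)
  show "Prim \<subseteq> FPi" by (auto simp: Prim_def)
  show "free_vs.subspace (Prim :: 'a fpi set)" by (rule Prim_subspace)
  fix f g :: "'a fpi" assume f: "f \<in> Prim" and g: "g \<in> Prim"
  from f obtain J where J: "finite J" "J \<subseteq> fin_subsets - {{}}" "f = (\<Sum>A\<in>J. component A f)"
    "\<And>A. A \<in> J \<Longrightarrow> component A f \<in> Prim \<inter> FPi_comp A" by (rule Prim_decompose) blast
  from g obtain K where K: "finite K" "K \<subseteq> fin_subsets - {{}}" "g = (\<Sum>B\<in>K. component B g)"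
    "\<And>B. B \<in> K \<Longrightarrow> component B g \<in> Prim \<inter> FPi_comp B" by (rule Prim_decompose) blast
  have "lie_prod f g = (\<Sum>A\<in>J. \<Sum>B\<in>K. lie_prod (component A f) (component B g))"
    by (subst J(3), subst K(3)) (simp only: lie_prod_sum_left lie_prod_sum_right, rule sum.swap)
  also have "\<dots> \<in> Prim"
    using J K by (intro free_vs.subspace_sum[OF Prim_subspace])
      (rule lie_prod_Prim_homogeneous; blast)
  finally show "lie_prod f g \<in> Prim" .
qed

section \<open>The elements \<open>e_elem A\<close> are primitive\<close>

text \<open>The compositions with prescribed restrictions to two complementary sets, listed by their
  first block: it is the first block of one of the restrictions, or the union of both.\<close>

fun quasi_shuffles :: "nat set list \<Rightarrow> nat set list \<Rightarrow> nat set list set" where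
  "quasi_shuffles [] R = {R}"
| "quasi_shuffles (q # Q) [] = {q # Q}"
| "quasi_shuffles (q # Q) (r # R) =
     (#) q ` quasi_shuffles Q (r # R) \<union> (#) r ` quasi_shuffles (q # Q) R \<union>
     (#) (q \<union> r) ` quasi_shuffles Q R"

lemma finite_quasi_shuffles: "finite (quasi_shuffles Q R)"
  by (induction Q R rule: quasi_shuffles.induct) auto

lemma restr_cong: "\<Union>(set P) \<inter> X = \<Union>(set P) \<inter> Y \<Longrightarrow> restr P X = restr P Y"
proof -
  assume eq: "\<Union>(set P) \<inter> X = \<Union>(set P) \<inter> Y"
  have "p \<inter> X = p \<inter> Y" if "p \<in> set P" for p
  proof -
    have "p \<inter> Z = p \<inter> (\<Union>(set P) \<inter> Z)" for Z
      using that by auto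
    then show ?thesis using eq by metis
  qed
  then show ?thesis by (simp add: restr_def cong: map_cong)
qed

lemma quasi_shuffles_Cons_iff:
  assumes Q: "q # Q \<in> set_comps X" and R: "r # R \<in> set_comps Y" and XY: "X \<inter> Y = {}"
  shows "p # P \<in> set_comps (X \<union> Y) \<and> restr (p # P) X = q # Q \<and> restr (p # P) Y = r # R \<longleftrightarrow>
    p = q \<and> P \<in> set_comps (X - q \<union> Y) \<and> restr P (X - q) = Q \<and> restr P Y = r # R \<or>
    p = r \<and> P \<in> set_comps (X \<union> (Y - r)) \<and> restr P X = q # Q \<and> restr P (Y - r) = R \<or>
    p = q \<union> r \<and> P \<in> set_comps (X - q \<union> (Y - r)) \<and> restr P (X - q) = Q \<and> restr P (Y - r) = R"
    (is "?L \<longleftrightarrow> ?A \<or> ?B \<or> ?C")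
proof -
  have q: "q \<noteq> {}" "q \<subseteq> X" "q \<inter> X = q" "q \<inter> Y = {}"
    and r: "r \<noteq> {}" "r \<subseteq> Y" "r \<inter> Y = r" "r \<inter> X = {}"
    using Q R XY by auto
  have sets: "X \<union> Y - q = X - q \<union> Y" "X \<union> Y - r = X \<union> (Y - r)"
    "X \<union> Y - (q \<union> r) = X - q \<union> (Y - r)"
    "(q \<union> r) \<inter> X = q" "(q \<union> r) \<inter> Y = r"
    using q r XY by auto
  have restr1: "restr P X = restr P (X - q)" if "P \<in> set_comps (X - q \<union> Z)" "Z \<subseteq> Y" for Z
    using that q by (intro restr_cong) (auto simp: Union_set_comps)
  have restr2: "restr P Y = restr P (Y - r)" if "P \<in> set_comps (Z \<union> (Y - r))" "Z \<subseteq> X" for Z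
    using that r by (intro restr_cong) (auto simp: Union_set_comps)
  have A: "?L \<longleftrightarrow> ?A" if "p = q"
    using that q r restr1[of Y] sets by auto
  have B: "?L \<longleftrightarrow> ?B" if "p = r"
    using that q r restr2[of X] sets by auto
  have C: "?L \<longleftrightarrow> ?C" if "p = q \<union> r"
    using that q r restr1[of "Y - r"] restr2[of "X - q"] sets by auto
  have first: "p = q \<or> p = r \<or> p = q \<union> r" if L: ?L
  proof -
    have "p = (p \<inter> X) \<union> (p \<inter> Y)" using L by auto
    moreover have "p \<inter> X = {} \<or> p \<inter> X = q" "p \<inter> Y = {} \<or> p \<inter> Y = r"
      using L by (auto split: if_splits)
    moreover have "p \<noteq> {}" using L by auto
    ultimately show ?thesis by (metis sup_bot.left_neutral sup_bot.right_neutral)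
  qed
  show ?thesis
  proof
    assume L: ?L
    from first[OF L] show "?A \<or> ?B \<or> ?C"
    proof (elim disjE)
      assume "p = q" then show ?thesis by (intro disjI1 A[THEN iffD1, OF _ L])
    next
      assume "p = r" then show ?thesis by (intro disjI2[OF disjI1] B[THEN iffD1, OF _ L])
    next
      assume "p = q \<union> r" then show ?thesis by (intro disjI2[OF disjI2] C[THEN iffD1, OF _ L])
    qed
  next
    assume "?A \<or> ?B \<or> ?C"
    then show ?L
    proof (elim disjE)
      assume a: ?A then show ?L by (rule A[OF conjunct1, THEN iffD2]) (rule a)
    next
      assume b: ?B then show ?L by (rule B[OF conjunct1, THEN iffD2]) (rule b)
    next
      assume c: ?C then show ?L by (rule C[OF conjunct1, THEN iffD2]) (rule c)
    qed
  qed
qed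

lemma quasi_shuffles_eq:
  assumes "Q \<in> set_comps X" "R \<in> set_comps Y" "X \<inter> Y = {}"
  shows "quasi_shuffles Q R = {P \<in> set_comps (X \<union> Y). restr P X = Q \<and> restr P Y = R}"
  using assms
proof (induction Q R arbitrary: X Y rule: quasi_shuffles.induct)
  case (1 R)
  then show ?case
    by (auto simp: restr_set_comps_self[OF _ order_refl] restr_eq_Nil)
next
  case (2 q Q)
  then show ?case
    by (auto simp: restr_set_comps_self[OF _ order_refl] restr_eq_Nil simp del: restr_Cons set_comps_Cons)
next
  case (3 q Q r R)
  have IH: "quasi_shuffles Q (r # R) =
      {P \<in> set_comps (X - q \<union> Y). restr P (X - q) = Q \<and> restr P Y = r # R}"
    "quasi_shuffles (q # Q) R =
      {P \<in> set_comps (X \<union> (Y - r)). restr P X = q # Q \<and> restr P (Y - r) = R}"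
    "quasi_shuffles Q R =
      {P \<in> set_comps (X - q \<union> (Y - r)). restr P (X - q) = Q \<and> restr P (Y - r) = R}"
    by (rule "3.IH"; use "3.prems" in auto)+
  show ?case
  proof (intro set_eqI)
    fix P
    show "P \<in> quasi_shuffles (q # Q) (r # R) \<longleftrightarrow>
      P \<in> {P \<in> set_comps (X \<union> Y). restr P X = q # Q \<and> restr P Y = r # R}"
    proof (cases P)
      case Nil
      then show ?thesis by auto
    next
      case (Cons p P')
      have "p # P' \<in> quasi_shuffles (q # Q) (r # R) \<longleftrightarrow>
          p = q \<and> P' \<in> quasi_shuffles Q (r # R) \<or>
          p = r \<and> P' \<in> quasi_shuffles (q # Q) R \<or>
          p = q \<union> r \<and> P' \<in> quasi_shuffles Q R"
        by auto
      then show ?thesis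
        unfolding Cons IH mem_Collect_eq quasi_shuffles_Cons_iff[OF "3.prems"] .
    qed
  qed
qed

text \<open>With \<open>s\<close> the claimed value, the three families of quasi-shuffles of \<open>q # Q\<close> and \<open>r # R\<close>
  contribute \<open>s\<close>, \<open>s\<close> and \<open>- s\<close>.\<close>

lemma sum_quasi_shuffles:
  assumes "Q \<in> set_comps X" "R \<in> set_comps Y" "X \<inter> Y = {}"
  shows "(\<Sum>P\<in>quasi_shuffles Q R. (- 1) ^ length P) = ((- 1) ^ (length Q + length R) :: 'a::field)"
  using assms
proof (induction Q R arbitrary: X Y rule: quasi_shuffles.induct)
  case (3 q Q r R)
  have q: "q \<noteq> {}" "r \<noteq> {}" "q \<inter> r = {}"
    using "3.prems" by auto
  then have ne: "q \<noteq> r" "q \<noteq> q \<union> r" "r \<noteq> q \<union> r"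
    by auto
  have IH: "(\<Sum>P\<in>quasi_shuffles Q (r # R). (- 1) ^ length P) = ((- 1) ^ (length Q + length (r # R)) :: 'a)"
    "(\<Sum>P\<in>quasi_shuffles (q # Q) R. (- 1) ^ length P) = ((- 1) ^ (length (q # Q) + length R) :: 'a)"
    "(\<Sum>P\<in>quasi_shuffles Q R. (- 1) ^ length P) = ((- 1) ^ (length Q + length R) :: 'a)"
    by (rule "3.IH"(1)[of "X - q" Y] "3.IH"(2)[of X "Y - r"] "3.IH"(3)[of "X - q" "Y - r"];
        use "3.prems" in auto)+
  have "(\<Sum>P\<in>quasi_shuffles (q # Q) (r # R). (- 1) ^ length P) =
      (\<Sum>P\<in>(#) q ` quasi_shuffles Q (r # R). (- 1) ^ length P) +
      (\<Sum>P\<in>(#) r ` quasi_shuffles (q # Q) R. (- 1) ^ length P) +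
      (\<Sum>P\<in>(#) (q \<union> r) ` quasi_shuffles Q R. (- 1 :: 'a) ^ length P)"
    using ne unfolding quasi_shuffles.simps
    by (subst sum.union_disjoint; (simp add: finite_quasi_shuffles)?; (blast)?)+
  also have "\<dots> = - ((- 1) ^ (length Q + length (r # R))) - (- 1) ^ (length (q # Q) + length R)
      - (- 1) ^ (length Q + length R)"
    by (simp add: sum.reindex sum_negf IH)
  finally show ?case by simp
qed simp_all

text \<open>The condition on \<open>a\<close> excludes the family that starts with \<open>r\<close>, and the other two cancel.\<close>

lemma sum_quasi_shuffles_first:
  assumes Q: "q # Q \<in> set_comps X" and R: "r # R \<in> set_comps Y" and XY: "X \<inter> Y = {}"
    and a: "a \<in> q"
  shows "(\<Sum>P | P \<in> quasi_shuffles (q # Q) (r # R) \<and> a \<in> hd P. (- 1) ^ (length P - 1)) = (0 :: 'a::field)"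
proof -
  have "a \<notin> r" "q \<noteq> q \<union> r" using assms by auto
  then have eq: "{P. P \<in> quasi_shuffles (q # Q) (r # R) \<and> a \<in> hd P} =
      (#) q ` quasi_shuffles Q (r # R) \<union> (#) (q \<union> r) ` quasi_shuffles Q R"
    using a by auto
  have "(\<Sum>P | P \<in> quasi_shuffles (q # Q) (r # R) \<and> a \<in> hd P. (- 1) ^ (length P - 1)) =
      (\<Sum>P\<in>quasi_shuffles Q (r # R). (- 1) ^ length P) +
      (\<Sum>P\<in>quasi_shuffles Q R. (- 1 :: 'a) ^ length P)"
    unfolding eq using \<open>q \<noteq> q \<union> r\<close>
    by (subst sum.union_disjoint) (auto simp: finite_quasi_shuffles sum.reindex)
  also have "\<dots> = (- 1) ^ (length Q + length (r # R)) + (- 1) ^ (length Q + length R)"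
    using Q R XY
    by (intro arg_cong2[where f = "(+)"] sum_quasi_shuffles[of _ "X - q" _ Y]
        sum_quasi_shuffles[of _ "X - q" _ "Y - r"]) auto
  finally show ?thesis by simp
qed

lemma lookup_e_elem:
  assumes "finite A"
  shows "Poly_Mapping.lookup (e_elem A :: 'a::field fpi) P =
    (if P \<in> set_comps A \<and> Min A \<in> hd P then (- 1) ^ (length P - 1) else 0)"
proof -
  let ?K = "{P. P \<in> set_comps A \<and> Min A \<in> hd P}"
  have "finite ?K"
    using finite_set_comps[OF assms] by simp
  moreover have "Poly_Mapping.lookup (e_elem A :: 'a fpi) P =
      (\<Sum>Q\<in>?K. if Q = P then (- 1) ^ (length P - 1) else 0)"
    unfolding e_elem_def lookup_sum
    by (rule sum.cong[OF refl]) (simp add: lookup_single when_def)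
  ultimately show ?thesis
    by (simp add: sum.delta)
qed

lemma e_elem_in_FPi_comp: "finite A \<Longrightarrow> e_elem A \<in> FPi_comp A"
  by (auto simp: FPi_comp_def in_keys_iff lookup_e_elem split: if_splits)

lemma hd_restr:
  assumes "P \<in> set_comps A" "A \<noteq> {}" "a \<in> hd P" "a \<in> X"
  shows "a \<in> hd (restr P X)"
  using assms by (cases P) auto

lemma e_elem_Prim:
  assumes A: "A \<in> fin_subsets" "A \<noteq> {}"
  shows "e_elem A \<in> (Prim :: 'a::field fpi set)"
proof -
  have fin: "finite A" using A by (simp add: fin_subsets_def)
  let ?K = "{P. P \<in> set_comps A \<and> Min A \<in> hd P}"
  have null: "(\<Sum>P | P \<in> ?K \<and> (restr P X, restr P Y) = (Q, R). (- 1) ^ (length P - 1)) = (0 :: 'a)"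
    if XY: "X \<noteq> {}" "Y \<noteq> {}" "X \<inter> Y = {}" "X \<union> Y = A" "Min A \<in> X"
      and Q: "Q \<in> set_comps X" and R: "R \<in> set_comps Y" for X Y Q R
  proof -
    obtain q Q' where q: "Q = q # Q'" using Q XY(1) by (cases Q) auto
    obtain r R' where r: "R = r # R'" using R XY(2) by (cases R) auto
    have eq: "{P. P \<in> ?K \<and> (restr P X, restr P Y) = (Q, R)} = {P. P \<in> quasi_shuffles Q R \<and> Min A \<in> hd P}"
      unfolding quasi_shuffles_eq[OF Q R XY(3)] using XY by auto
    show ?thesis
    proof (cases "Min A \<in> q")
      case True
      show ?thesis
        unfolding eq unfolding q r
        by (rule sum_quasi_shuffles_first[OF _ _ XY(3) True]) (use Q R q r in auto)
    next
      case False
      have "Min A \<in> q" if "P \<in> set_comps A" "restr P X = Q" "Min A \<in> hd P" for P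
        using hd_restr[OF that(1) A(2) that(3) XY(5)] that(2) q by simp
      with False have empty: "{P. P \<in> quasi_shuffles Q R \<and> Min A \<in> hd P} = {}"
        unfolding quasi_shuffles_eq[OF Q R XY(3)] XY(4) by blast
      show ?thesis unfolding eq empty by simp
    qed
  qed
  show ?thesis
    unfolding Prim_homogeneous_iff[OF A e_elem_in_FPi_comp[OF fin]]
  proof (intro allI impI)
    fix X Y and \<phi> :: "nat set list \<Rightarrow> nat set list \<Rightarrow> 'a"
    assume XY: "X \<noteq> {}" "Y \<noteq> {}" "X \<inter> Y = {}" "X \<union> Y = A"
    have finXY: "finite X" "finite Y" using fin XY(4) by auto
    have null2: "(\<Sum>P | P \<in> ?K \<and> (restr P X, restr P Y) = (Q, R). (- 1) ^ (length P - 1)) = (0 :: 'a)"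
      if QR: "Q \<in> set_comps X" "R \<in> set_comps Y" for Q R
    proof (cases "Min A \<in> X")
      case True
      with null[OF XY True QR] show ?thesis by simp
    next
      case False
      then have "Min A \<in> Y" using Min_in[OF fin A(2)] XY(4) by blast
      then show ?thesis
        using null[of Y X R Q] XY QR by (simp add: Int_commute Un_commute conj_commute)
    qed
    have "pairing (e_elem A) (\<lambda>P. \<phi> (restr P X) (restr P Y)) =
        (\<Sum>P\<in>?K. (- 1) ^ (length P - 1) * \<phi> (restr P X) (restr P Y))"
      by (simp add: e_elem_def)
    also have "\<dots> = (\<Sum>QR\<in>set_comps X \<times> set_comps Y.
        \<Sum>P | P \<in> ?K \<and> (restr P X, restr P Y) = QR.
          (- 1) ^ (length P - 1) * \<phi> (restr P X) (restr P Y))"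
      using finite_set_comps[OF fin] finite_set_comps[OF finXY(1)] finite_set_comps[OF finXY(2)]
      by (intro sum.group[symmetric]) (auto dest: restr_set_comps[of _ _ X] restr_set_comps[of _ _ Y]
          simp: XY(4)[symmetric])
    also have "\<dots> = 0"
    proof (rule sum.neutral, clarify)
      fix Q R assume QR: "Q \<in> set_comps X" "R \<in> set_comps Y"
      have "(\<Sum>P | P \<in> ?K \<and> (restr P X, restr P Y) = (Q, R).
            (- 1) ^ (length P - 1) * \<phi> (restr P X) (restr P Y)) =
          (\<Sum>P | P \<in> ?K \<and> (restr P X, restr P Y) = (Q, R). (- 1) ^ (length P - 1)) * \<phi> Q R"
        unfolding sum_distrib_right by (rule sum.cong) auto
      also have "\<dots> = 0" unfolding null2[OF QR] by simp
      finally show "(\<Sum>P | P \<in> ?K \<and> (restr P X, restr P Y) = (Q, R).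
            (- 1) ^ (length P - 1) * \<phi> (restr P X) (restr P Y)) = 0" .
    qed
    finally show "pairing (e_elem A) (\<lambda>P. \<phi> (restr P X) (restr P Y)) = 0" .
  qed
qed

section \<open>The graded components as right ideals\<close>

lemma lookup_e_elem_singleton:
  "finite A \<Longrightarrow> A \<noteq> {} \<Longrightarrow> Poly_Mapping.lookup (e_elem A) [A] = 1"
  by (simp add: lookup_e_elem)

text \<open>Every primitive element with one-block coefficient 1 acts on the primitive elements as a
  left unit, and its products \<open>e \<curlywedge> g\<close> are primitive.\<close>

lemma right_ideal_Prim:
  assumes A: "A \<in> fin_subsets" "A \<noteq> {}"
    and e: "e \<in> Prim" "e \<in> FPi_comp A" "Poly_Mapping.lookup e [A] = 1"
  shows "right_ideal (e :: 'a::field fpi) A = Prim \<inter> FPi_comp A"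
proof (intro equalityI subsetI)
  fix f assume "f \<in> right_ideal e A"
  then obtain g where "g \<in> FPi_comp A" "f = e \<curlywedge> g" by (auto simp: right_ideal_def)
  then show "f \<in> Prim \<inter> FPi_comp A"
    using wedge_Prim_left[OF e(1) A e(2)] wedge_in_FPi_comp[OF e(2)] by auto
next
  fix f :: "'a fpi" assume f: "f \<in> Prim \<inter> FPi_comp A"
  then have "f = e \<curlywedge> f"
    using wedge_Prim_right[of f A e] A e by simp
  with f show "f \<in> right_ideal e A" by (auto simp: right_ideal_def)
qed

lemma right_ideal_e_elem:
  assumes "A \<in> fin_subsets" "A \<noteq> {}"
  shows "right_ideal (e_elem A) A = Prim \<inter> FPi_comp A"
  using assms
  by (intro right_ideal_Prim e_elem_Prim e_elem_in_FPi_comp lookup_e_elem_singleton)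
     (auto simp: fin_subsets_def)

lemma idempotent_Prim:
  assumes A: "A \<in> fin_subsets" "A \<noteq> {}"
    and e: "e \<in> Prim" "e \<in> FPi_comp A" "Poly_Mapping.lookup e [A] = 1"
  shows "idempotent e"
  using wedge_Prim_right[of e A e] A e by (auto simp: idempotent_def)

text \<open>A primitive \<open>f\<close> with one-block coefficient \<open>c\<close> equals \<open>(f - c e + e) + (c - 1) e\<close> with
  \<open>e = e_elem A\<close>, where both \<open>e\<close> and \<open>f - c e + e\<close> have one-block coefficient 1.\<close>

lemma right_ideal_eq_span_idempotents:
  assumes A: "A \<in> fin_subsets" "A \<noteq> {}"
  shows "(right_ideal (e_elem A) A :: 'a::field fpi set) =
    free_vs.span {e \<in> FPi_comp A. idempotent e \<and> right_ideal e A = right_ideal (e_elem A) A}"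
    (is "_ = free_vs.span ?S")
proof -
  let ?e = "e_elem A :: 'a fpi"
  let ?V = "Prim \<inter> FPi_comp A :: 'a fpi set"
  have fin: "finite A" using A by (simp add: fin_subsets_def)
  have sub: "free_vs.subspace ?V"
    by (intro free_vs.subspace_inter Prim_subspace FPi_comp_subspace)
  have e: "?e \<in> ?V" "Poly_Mapping.lookup ?e [A] = 1"
    using e_elem_Prim[OF A] e_elem_in_FPi_comp[OF fin] lookup_e_elem_singleton[OF fin A(2)] by auto
  have inS: "x \<in> ?S" if "x \<in> ?V" "Poly_Mapping.lookup x [A] = 1" for x
    using that idempotent_Prim[OF A, of x] right_ideal_Prim[OF A, of x] right_ideal_e_elem[OF A] by auto
  have "?V = free_vs.span ?S"
  proof
    have "?S \<subseteq> ?V"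
    proof
      fix x assume x: "x \<in> ?S"
      then have "x = x \<curlywedge> x" by (simp add: idempotent_def)
      with x have "x \<in> right_ideal x A" by (auto simp: right_ideal_def)
      with x show "x \<in> ?V" using right_ideal_e_elem[OF A] by auto
    qed
    then show "free_vs.span ?S \<subseteq> ?V"
      using sub by (intro free_vs.span_minimal)
    show "?V \<subseteq> free_vs.span ?S"
    proof
      fix f assume f: "f \<in> ?V"
      define c where "c = Poly_Mapping.lookup f [A]"
      let ?x = "f - fscale c ?e + ?e"
      have "?x \<in> ?V"
        using f e(1) sub
        by (intro free_vs.subspace_add free_vs.subspace_diff free_vs.subspace_scale)
      moreover have "Poly_Mapping.lookup ?x [A] = 1"
        using e(2) by (simp add: lookup_add lookup_minus c_def)
      ultimately have "?x + fscale (c - 1) ?e \<in> free_vs.span ?S"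
        using e by (intro free_vs.span_add free_vs.span_scale free_vs.span_base inS)
      moreover have "?x + fscale (c - 1) ?e = f"
        by (simp add: free_vs.scale_left_diff_distrib)
      ultimately show "f \<in> free_vs.span ?S"
        by simp
    qed
  qed
  then show ?thesis by (simp add: right_ideal_e_elem[OF A])
qed

lemma internal_direct_sum_Prim:
  "internal_direct_sum (fin_subsets - {{}}) (\<lambda>A. Prim \<inter> FPi_comp A) (Prim :: 'a::field fpi set)"
  unfolding internal_direct_sum_def
proof (intro conjI ballI allI impI)
  fix A :: "nat set"
  show "free_vs.subspace (Prim \<inter> FPi_comp A :: 'a fpi set)"
    by (intro free_vs.subspace_inter Prim_subspace FPi_comp_subspace)
next
  show "(Prim :: 'a fpi set) = {(\<Sum>A\<in>J. w A) | J w. finite J \<and> J \<subseteq> fin_subsets - {{}} \<and>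
      (\<forall>A\<in>J. w A \<in> Prim \<inter> FPi_comp A)}" (is "_ = ?R")
  proof (intro equalityI subsetI)
    fix f :: "'a fpi" assume "f \<in> Prim"
    then show "f \<in> ?R"
      by (rule Prim_decompose) blast
  next
    fix f :: "'a fpi" assume "f \<in> ?R"
    then show "f \<in> Prim"
      by (auto intro!: free_vs.subspace_sum[OF Prim_subspace])
  qed
next
  fix J and w :: "nat set \<Rightarrow> 'a fpi" and A
  assume J: "finite J \<and> J \<subseteq> fin_subsets - {{}} \<and> (\<forall>A\<in>J. w A \<in> Prim \<inter> FPi_comp A) \<and> sum w J = 0"
    and A: "A \<in> J"
  have "component A (sum w J) = (\<Sum>B\<in>J. if B = A then w A else 0)"
    unfolding component_sum
  proof (rule sum.cong[OF refl])
    fix B assume "B \<in> J"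
    then have "w B \<in> FPi_comp B" using J by auto
    then show "component A (w B) = (if B = A then w A else 0)"
      by (cases "B = A") (simp_all add: component_self component_other)
  qed
  then have "component A (0 :: 'a fpi) = w A"
    using J A by (simp add: sum.delta)
  moreover have "component A (0 :: 'a fpi) = 0"
    by (simp add: component_def linear_ext_def)
  ultimately show "w A = 0" by simp
qed

section \<open>A basis of each graded component\<close>

lemma restr_append_parts:
  assumes "P \<in> set_comps A" "Q \<in> set_comps B" "A \<inter> B = {}"
  shows "restr (P @ Q) A = P" "restr (P @ Q) B = Q"
  using assms
  by (simp_all add: restr_set_comps_self[OF _ order_refl] restr_set_comps_disjoint Int_commute)

text \<open>Let \<open>P = P\<^sub>1 @ P\<^sub>2\<close> where \<open>a\<close> lies in the first block of \<open>P\<^sub>2\<close>. The compositions with the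
  same restrictions to \<open>\<Union>(set P\<^sub>1)\<close> and to its complement as \<open>P\<close> are \<open>P\<close> itself and others
  in which fewer elements precede the block of \<open>a\<close>. Primitivity makes the sum of the coefficients
  of all of these vanish, so each coefficient is determined by those in which fewer elements precede
  \<open>a\<close>, and finally by those in which \<open>a\<close> is in the first block.\<close>

lemma Prim_eq_0_if_first_block_eq_0:
  assumes A: "A \<in> fin_subsets" "a \<in> A"
    and f: "f \<in> Prim" "f \<in> FPi_comp A"
    and zero: "\<And>P. P \<in> set_comps A \<Longrightarrow> a \<in> hd P \<Longrightarrow> Poly_Mapping.lookup f P = 0"
  shows "f = 0"
proof -
  have fin: "finite A" using A by (simp add: fin_subsets_def)
  have vanish: "Poly_Mapping.lookup f (P1 @ p # P2) = 0" if "P1 @ p # P2 \<in> set_comps A" "a \<in> p" for P1 p P2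
    using that
  proof (induction "card (\<Union>(set P1))" arbitrary: P1 p P2 rule: less_induct)
    case less
    let ?X = "\<Union>(set P1)"
    let ?Y = "A - ?X"
    have P1: "P1 \<in> set_comps ?X" "?X \<subseteq> A" and pP2: "p # P2 \<in> set_comps ?Y"
      using less.prems(1) unfolding set_comps_append by auto
    show ?case
    proof (cases "P1 = []")
      case True
      then show ?thesis using zero less.prems by auto
    next
      case False
      have "?X \<noteq> {}"
        using P1(1) False by (cases P1) auto
      have aY: "a \<in> ?Y" using pP2 less.prems(2) by auto
      have iff: "restr P ?X = P1 \<and> restr P ?Y = p # P2 \<longleftrightarrow> P = P1 @ p # P2"
        if P: "P \<in> Poly_Mapping.keys f" for P
      proof
        assume "P = P1 @ p # P2"
        then show "restr P ?X = P1 \<and> restr P ?Y = p # P2"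
          using restr_append_parts[OF P1(1) pP2 Diff_disjoint] by blast
      next
        assume eq: "restr P ?X = P1 \<and> restr P ?Y = p # P2"
        have PA: "P \<in> set_comps A" by (rule FPi_comp_keysD[OF f(2) P])
        then obtain q where "q \<in> set P" "a \<in> q"
          using A(2) by (auto dest: Union_set_comps)
        then obtain Q1 Q2 where Q: "P = Q1 @ q # Q2" by (auto dest: split_list)
        have Q1: "\<Union>(set Q1) \<subseteq> A" "Q1 \<in> set_comps (\<Union>(set Q1))"
          and qQ2: "q # Q2 \<in> set_comps (A - \<Union>(set Q1))"
          using PA unfolding Q set_comps_append by auto
        have "a \<notin> \<Union>(set Q1)"
          using qQ2 \<open>a \<in> q\<close> by auto
        \<comment> \<open>Otherwise the first block of \<open>restr P ?Y\<close>, which contains \<open>a\<close>, would come from a block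
          of \<open>P\<close> before the block of \<open>a\<close>.\<close>
        have "restr Q1 ?Y = []"
        proof (cases "restr Q1 ?Y")
          case (Cons r R)
          have "r = p" using eq unfolding Q restr_append Cons by simp
          then have "a \<in> \<Union>(set (restr Q1 ?Y))"
            using less.prems(2) unfolding Cons by simp
          then show ?thesis using \<open>a \<notin> \<Union>(set Q1)\<close> by simp
        qed simp
        then have sub: "\<Union>(set Q1) \<subseteq> ?X"
          using Q1(1) unfolding restr_eq_Nil by blast
        have "\<Union>(set Q1) = ?X"
        proof (rule ccontr)
          assume "\<Union>(set Q1) \<noteq> ?X"
          then have "card (\<Union>(set Q1)) < card ?X"
            using sub finite_subset[OF P1(2) fin] by (intro psubset_card_mono psubsetI)
          then have "Poly_Mapping.lookup f P = 0"
            unfolding Q using PA \<open>a \<in> q\<close> unfolding Q by (rule less.hyps)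
          then show False using P by (simp add: in_keys_iff)
        qed
        then have "restr P ?X = Q1" "restr P ?Y = q # Q2"
          using restr_append_parts[OF Q1(2) qQ2 Diff_disjoint] unfolding Q by argo+
        then show "P = P1 @ p # P2" using eq Q by simp
      qed
      have "pairing f (\<lambda>P. (\<lambda>u v. if u = P1 \<and> v = p # P2 then 1 else 0) (restr P ?X) (restr P ?Y)) = 0"
        using \<open>?X \<noteq> {}\<close> aY P1(2) by (intro Prim_pairing_eq_0[OF f(1) A(1) f(2)]) auto
      then have "pairing f (\<lambda>P. if P = P1 @ p # P2 then 1 else 0) = 0"
        using iff by (simp cong: pairing_cong)
      then show ?thesis by (simp add: lookup_eq_pairing)
    qed
  qed
  have "Poly_Mapping.keys f = {}"
  proof (rule equals0I)
    fix P assume P: "P \<in> Poly_Mapping.keys f"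
    have "a \<in> \<Union>(set P)" using FPi_comp_Union[OF f(2) P] A(2) by simp
    then obtain p where p: "p \<in> set P" "a \<in> p" by auto
    then obtain P1 P2 where "P = P1 @ p # P2" by (auto dest: split_list)
    with vanish p(2) FPi_comp_keysD[OF f(2) P] have "Poly_Mapping.lookup f P = 0" by auto
    with P show False by (simp add: in_keys_iff)
  qed
  then show ?thesis by simp
qed

lemma keys_vee:
  assumes "f \<in> FPi_comp A" "g \<in> FPi_comp B" "A \<inter> B = {}"
    and "T \<in> Poly_Mapping.keys (f \<curlyvee> g)"
  obtains P Q where "T = P @ Q" "P \<in> Poly_Mapping.keys f" "Q \<in> Poly_Mapping.keys g"
proof -
  have "Poly_Mapping.keys (f \<curlyvee> g) \<subseteq>
      {P @ Q | P Q. P \<in> Poly_Mapping.keys f \<and> Q \<in> Poly_Mapping.keys g}"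
    by (rule keys_subsetI) (auto simp: pairing_vee_disjoint[OF assms(1-3)] intro!: pairing_zero_fun)
  with assms(4) that show thesis by auto
qed

lemma lookup_vee:
  assumes f: "f \<in> FPi_comp A" and g: "g \<in> FPi_comp B" and AB: "A \<inter> B = {}"
    and P: "P \<in> set_comps A" and Q: "Q \<in> set_comps B"
  shows "Poly_Mapping.lookup (f \<curlyvee> g) (P @ Q) = Poly_Mapping.lookup f P * Poly_Mapping.lookup g Q"
proof -
  have eq: "(if P' @ Q' = P @ Q then 1 else 0) = (if P' = P then (if Q' = Q then 1 else 0) else 0 :: 'a)"
    if "P' \<in> Poly_Mapping.keys f" "Q' \<in> Poly_Mapping.keys g" for P' Q'
  proof -
    have "P' = P" if "P' @ Q' = P @ Q"
      using restr_append_parts(1)[OF FPi_comp_keysD[OF f] FPi_comp_keysD[OF g] AB, of P' Q']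
        \<open>P' \<in> Poly_Mapping.keys f\<close> \<open>Q' \<in> Poly_Mapping.keys g\<close>
      unfolding that restr_append_parts(1)[OF P Q AB] by simp
    then show ?thesis by auto
  qed
  have "Poly_Mapping.lookup (f \<curlyvee> g) (P @ Q) = pairing f (\<lambda>P'. pairing g (\<lambda>Q'.
      if P' = P then (if Q' = Q then 1 else 0) else 0))"
    unfolding lookup_eq_pairing pairing_vee_disjoint[OF f g AB] by (intro pairing_cong eq)
  also have "\<dots> = pairing f (\<lambda>P'. if P' = P then Poly_Mapping.lookup g Q else 0)"
    by (rule pairing_cong) (simp add: pairing_delta pairing_zero_fun)
  finally show ?thesis by (simp add: pairing_delta)
qed

text \<open>The witness is the bracket, nested to the left, of the elements \<open>e_elem p\<close> over the blocks
  \<open>p\<close> of \<open>P\<close>. In \<open>lie_prod f g = f \<curlyvee> g - g \<curlyvee> f\<close>, with \<open>g\<close> the last of these, only \<open>f \<curlyvee> g\<close>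
  has terms whose first block contains the minimum, and \<open>e_elem p\<close> is \<open>[p]\<close> plus longer compositions.\<close>

lemma Prim_leading_term:
  assumes "P \<in> set_comps B" "B \<in> fin_subsets" "B \<noteq> {}" "Min B \<in> hd P"
  shows "\<exists>f \<in> (Prim :: 'a::field fpi set) \<inter> FPi_comp B. Poly_Mapping.lookup f P = 1 \<and>
    (\<forall>T. Poly_Mapping.lookup f T \<noteq> 0 \<longrightarrow> Min B \<in> hd T \<longrightarrow> T = P \<or> length P < length T)"
  using assms
proof (induction P arbitrary: B rule: rev_induct)
  case Nil
  then show ?case by simp
next
  case (snoc C P)
  have fin: "finite B" using snoc.prems by (simp add: fin_subsets_def)
  have long: "T = [D] \<or> 2 \<le> length T" if "T \<in> set_comps D" "D \<noteq> {}" for T D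
    using that by (cases T; cases "tl T") (auto simp: Diff_eq_empty_iff)
  show ?case
  proof (cases "P = []")
    case True
    then have "C = B" using snoc.prems by auto
    moreover have "T = [B] \<or> 2 \<le> length T" if "Poly_Mapping.lookup (e_elem B :: 'a fpi) T \<noteq> 0" for T
      using that long[of T B] snoc.prems(3) by (auto simp: lookup_e_elem[OF fin] split: if_splits)
    ultimately show ?thesis
      using True e_elem_Prim[OF snoc.prems(2,3)] e_elem_in_FPi_comp[OF fin]
        lookup_e_elem_singleton[OF fin snoc.prems(3)]
      by (intro bexI[of _ "e_elem B"]) (auto simp: numeral_2_eq_2 Suc_le_eq)
  next
    case False
    define B' where "B' = \<Union>(set P)"
    have B': "B' \<subseteq> B" "P \<in> set_comps B'" "C = B - B'" "C \<noteq> {}"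
      using snoc.prems(1) by (auto simp: B'_def Diff_eq_empty_iff)
    have disj: "B' \<inter> C = {}" "C \<inter> B' = {}" "B' \<union> C = B" using B' by auto
    have "B' \<noteq> {}" using B'(2) False by (cases P) auto
    have fs: "B' \<in> fin_subsets" "C \<in> fin_subsets"
      using snoc.prems(2) B' by (auto simp: fin_subsets_def intro: finite_subset)
    have hd: "hd T \<subseteq> D" if "T \<in> set_comps D" "D \<noteq> {}" for T D
      using that by (cases T) auto
    have "Min B \<in> hd P" using snoc.prems(4) False by simp
    with hd[OF B'(2) \<open>B' \<noteq> {}\<close>] have minB': "Min B \<in> B'" by auto
    have Min: "Min B' = Min B"
      using B'(1) fin minB' by (intro Min_eqI) (auto intro: finite_subset)
    obtain f :: "'a fpi" where f: "f \<in> Prim" "f \<in> FPi_comp B'" "Poly_Mapping.lookup f P = 1"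
      "\<And>T. Poly_Mapping.lookup f T \<noteq> 0 \<Longrightarrow> Min B \<in> hd T \<Longrightarrow> T = P \<or> length P < length T"
      using snoc.IH[OF B'(2) fs(1) \<open>B' \<noteq> {}\<close>] \<open>Min B \<in> hd P\<close> Min by auto
    let ?e = "e_elem C :: 'a fpi"
    have finC: "finite C" using fs by (simp add: fin_subsets_def)
    have e: "?e \<in> Prim" "?e \<in> FPi_comp C" "Poly_Mapping.lookup ?e [C] = 1"
      using e_elem_Prim[OF fs(2) B'(4)] e_elem_in_FPi_comp[OF finC]
        lookup_e_elem_singleton[OF finC B'(4)] by auto
    \<comment> \<open>The terms of \<open>e_elem C \<curlyvee> f\<close> start inside \<open>C\<close>.\<close>
    have first: "Poly_Mapping.lookup (lie_prod f ?e) T = Poly_Mapping.lookup (f \<curlyvee> ?e) T"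
      if T: "Min B \<in> hd T" for T
    proof -
      have "T \<notin> Poly_Mapping.keys (?e \<curlyvee> f)"
      proof
        assume "T \<in> Poly_Mapping.keys (?e \<curlyvee> f)"
        then obtain R S where RS: "T = R @ S" "R \<in> Poly_Mapping.keys ?e"
          by (rule keys_vee[OF e(2) f(2) disj(2)])
        have R: "R \<in> set_comps C" by (rule FPi_comp_keysD[OF e(2) RS(2)])
        then have "R \<noteq> []" using B'(4) by auto
        then have "Min B \<in> C" using hd[OF R B'(4)] T RS(1) by auto
        with minB' disj show False by auto
      qed
      then show ?thesis by (simp add: lie_prod_def lookup_minus in_keys_iff)
    qed
    show ?thesis
    proof (intro bexI[of _ "lie_prod f ?e"] conjI allI impI IntI)
      show "lie_prod f ?e \<in> Prim"
        by (rule lie_prod_Prim_homogeneous[OF f(1) fs(1) \<open>B' \<noteq> {}\<close> f(2) e(1) fs(2) B'(4) e(2)])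
      show "lie_prod f ?e \<in> FPi_comp B"
        using lie_prod_in_FPi_comp[OF f(2) e(2) disj(1)] disj(3) by simp
      show "Poly_Mapping.lookup (lie_prod f ?e) (P @ [C]) = 1"
        using first[OF snoc.prems(4)] lookup_vee[OF f(2) e(2) disj(1) B'(2), of "[C]"] f(3) e(3) B'(4)
        by simp
      fix T assume T: "Poly_Mapping.lookup (lie_prod f ?e) T \<noteq> 0" "Min B \<in> hd T"
      then have "T \<in> Poly_Mapping.keys (f \<curlyvee> ?e)" by (simp add: first in_keys_iff)
      then obtain R S where RS: "T = R @ S" "R \<in> Poly_Mapping.keys f" "S \<in> Poly_Mapping.keys ?e"
        by (rule keys_vee[OF f(2) e(2) disj(1)])
      have R: "R \<in> set_comps B'" and S: "S \<in> set_comps C"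
        using FPi_comp_keysD[OF f(2) RS(2)] FPi_comp_keysD[OF e(2) RS(3)] by auto
      have "R \<noteq> []" using R \<open>B' \<noteq> {}\<close> by auto
      then have "R = P \<or> length P < length R"
        using f(4)[of R] RS T(2) by (simp add: in_keys_iff)
      moreover have "S = [C] \<or> 2 \<le> length S" using long[OF S B'(4)] .
      ultimately show "T = P @ [C] \<or> length (P @ [C]) < length T"
        unfolding RS(1) by auto
    qed
  qed
qed

abbreviation first_block_comps :: "nat set \<Rightarrow> nat \<Rightarrow> nat set list set" where
  "first_block_comps A a \<equiv> {P \<in> set_comps A. a \<in> hd P}"

text \<open>Subtracting the longer terms, longest first, turns the leading terms into a dual basis.\<close>

lemma Prim_dual_basis:
  assumes A: "A \<in> fin_subsets" "A \<noteq> {}" and P: "P \<in> first_block_comps A (Min A)"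
  shows "\<exists>f \<in> (Prim :: 'a::field fpi set) \<inter> FPi_comp A.
    \<forall>T \<in> first_block_comps A (Min A). Poly_Mapping.lookup f T = (if T = P then 1 else 0)"
  using P
proof (induction "card A - length P" arbitrary: P rule: less_induct)
  case less
  let ?K = "first_block_comps A (Min A)"
  let ?L = "{T \<in> ?K. length P < length T}"
  let ?V = "(Prim :: 'a fpi set) \<inter> FPi_comp A"
  have fin: "finite A" using A by (simp add: fin_subsets_def)
  have finL: "finite ?L" using finite_set_comps[OF fin] by auto
  have sub: "free_vs.subspace ?V"
    by (intro free_vs.subspace_inter Prim_subspace FPi_comp_subspace)
  obtain f where f: "f \<in> ?V" "Poly_Mapping.lookup f P = 1"
    "\<And>T. Poly_Mapping.lookup f T \<noteq> 0 \<Longrightarrow> Min A \<in> hd T \<Longrightarrow> T = P \<or> length P < length T"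
    using Prim_leading_term[of P A] A less.prems by blast
  have "\<forall>T \<in> ?L. \<exists>f. f \<in> ?V \<and> (\<forall>S \<in> ?K. Poly_Mapping.lookup f S = (if S = T then 1 else 0))"
  proof
    fix T assume T: "T \<in> ?L"
    then have "card A - length T < card A - length P" "T \<in> ?K"
      using length_set_comps[of T A] fin by auto
    from less.hyps[OF this]
    show "\<exists>f. f \<in> ?V \<and> (\<forall>S \<in> ?K. Poly_Mapping.lookup f S = (if S = T then 1 else 0))"
      by (simp only: Bex_def)
  qed
  from bchoice[OF this] obtain b where b: "\<And>T. T \<in> ?L \<Longrightarrow> b T \<in> ?V"
    "\<And>T S. T \<in> ?L \<Longrightarrow> S \<in> ?K \<Longrightarrow> Poly_Mapping.lookup (b T) S = (if S = T then 1 else 0)"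
    by blast
  let ?g = "f - (\<Sum>T\<in>?L. fscale (Poly_Mapping.lookup f T) (b T))"
  have "?g \<in> ?V"
    using f(1) b(1) sub
    by (intro free_vs.subspace_diff free_vs.subspace_sum free_vs.subspace_scale)
  moreover have "Poly_Mapping.lookup ?g S = (if S = P then 1 else 0)" if S: "S \<in> ?K" for S
  proof -
    have "Poly_Mapping.lookup ?g S = Poly_Mapping.lookup f S -
        (\<Sum>T\<in>?L. if S = T then Poly_Mapping.lookup f S else 0)"
      unfolding lookup_minus lookup_sum lookup_fscale
      using b(2) S by (intro arg_cong2[where f = "(-)"] sum.cong refl) simp
    also have "\<dots> = Poly_Mapping.lookup f S - (if S \<in> ?L then Poly_Mapping.lookup f S else 0)"
      using finL by (simp add: sum.delta')
    also have "\<dots> = (if S = P then 1 else 0)"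
      using f(2) f(3)[of S] S by auto
    finally show ?thesis .
  qed
  ultimately show ?case by blast
qed

lemma dim_Prim_component:
  assumes A: "A \<in> fin_subsets" "A \<noteq> {}"
  shows "free_vs.dim ((Prim :: 'a::field fpi set) \<inter> FPi_comp A) = card (first_block_comps A (Min A))"
proof -
  let ?K = "first_block_comps A (Min A)"
  let ?V = "(Prim :: 'a fpi set) \<inter> FPi_comp A"
  have fin: "finite A" using A by (simp add: fin_subsets_def)
  have finK: "finite ?K" using finite_set_comps[OF fin] by auto
  have sub: "free_vs.subspace ?V"
    by (intro free_vs.subspace_inter Prim_subspace FPi_comp_subspace)
  have "\<forall>P \<in> ?K. \<exists>f. f \<in> ?V \<and> (\<forall>T \<in> ?K. Poly_Mapping.lookup f T = (if T = P then 1 else 0))"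
    using Prim_dual_basis[OF A] by (simp only: Bex_def) blast
  from bchoice[OF this] obtain b :: "nat set list \<Rightarrow> 'a fpi" where b: "\<And>P. P \<in> ?K \<Longrightarrow> b P \<in> ?V"
    "\<And>P T. P \<in> ?K \<Longrightarrow> T \<in> ?K \<Longrightarrow> Poly_Mapping.lookup (b P) T = (if T = P then 1 else 0)"
    by blast
  have lookup_sum_b: "Poly_Mapping.lookup (\<Sum>P\<in>?K. fscale (c P) (b P)) T = c T" if T: "T \<in> ?K" for c T
  proof -
    have "Poly_Mapping.lookup (\<Sum>P\<in>?K. fscale (c P) (b P)) T = (\<Sum>P\<in>?K. if T = P then c T else 0)"
      unfolding lookup_sum lookup_fscale using b(2) T by (intro sum.cong refl) simp
    then show ?thesis using finK T by (simp add: sum.delta')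
  qed
  have inj: "inj_on b ?K"
  proof (rule inj_onI)
    fix P Q assume PQ: "P \<in> ?K" "Q \<in> ?K" "b P = b Q"
    have "Poly_Mapping.lookup (b P) P = 1" "Poly_Mapping.lookup (b Q) P = (if P = Q then 1 else 0)"
      using b(2)[OF PQ(1) PQ(1)] b(2)[OF PQ(2) PQ(1)] by auto
    with PQ(3) show "P = Q" by (auto split: if_splits)
  qed
  have indep: "free_vs.independent (b ` ?K)"
  proof (rule free_vs.independent_if_scalars_zero)
    show "finite (b ` ?K)" using finK by simp
    fix u x assume u: "(\<Sum>x\<in>b ` ?K. fscale (u x) x) = 0" and "x \<in> b ` ?K"
    then obtain P where P: "P \<in> ?K" "x = b P" by auto
    have "(\<Sum>P\<in>?K. fscale (u (b P)) (b P)) = 0"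
      using u by (simp add: sum.reindex[OF inj])
    then show "u x = 0"
      using lookup_sum_b[OF P(1), of "\<lambda>P. u (b P)"] P(2) by simp
  qed
  have span: "?V \<subseteq> free_vs.span (b ` ?K)"
  proof
    fix f assume f: "f \<in> ?V"
    let ?s = "\<Sum>P\<in>?K. fscale (Poly_Mapping.lookup f P) (b P)"
    have "f - ?s \<in> ?V"
      using f b(1) sub
      by (intro free_vs.subspace_diff free_vs.subspace_sum free_vs.subspace_scale)
    then have "f - ?s = 0"
      using lookup_sum_b[of _ "Poly_Mapping.lookup f"] Min_in[OF fin A(2)]
      by (intro Prim_eq_0_if_first_block_eq_0[OF A(1), of "Min A"]) (auto simp: lookup_minus)
    moreover have "?s \<in> free_vs.span (b ` ?K)"
      by (intro free_vs.span_sum free_vs.span_scale free_vs.span_base imageI)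
    ultimately show "f \<in> free_vs.span (b ` ?K)" by simp
  qed
  have "b ` ?K \<subseteq> ?V" using b(1) by blast
  from free_vs.basis_card_eq_dim[OF this span indep] show ?thesis
    using card_image[OF inj] by simp
qed

section \<open>Counting\<close>

lemma map_image_set_comps:
  assumes "inj_on h A" "P \<in> set_comps A"
  shows "map ((`) h) P \<in> set_comps (h ` A)"
  using assms
proof (induction P arbitrary: A)
  case (Cons p P)
  have "map ((`) h) P \<in> set_comps (h ` (A - p))"
    using Cons.prems by (intro Cons.IH) (auto intro: inj_on_subset)
  moreover have "h ` (A - p) = h ` A - h ` p"
    using Cons.prems by (intro inj_on_image_set_diff[of h A]) auto
  ultimately show ?case using Cons.prems by auto
qed simp

lemma card_set_comps_le:
  assumes "finite A" "finite B" "card A = card B"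
  shows "card (set_comps A) \<le> card (set_comps B)"
proof -
  obtain h where h: "bij_betw h A B"
    using finite_same_card_bij[OF assms] by blast
  then have inj: "inj_on h A" and img: "h ` A = B" by (auto simp: bij_betw_def)
  have "inj_on (map ((`) h)) (set_comps A)"
  proof (rule inj_onI)
    fix P Q assume P: "P \<in> set_comps A" and Q: "Q \<in> set_comps A"
      and eq: "map ((`) h) P = map ((`) h) Q"
    have "inj_on ((`) h) (set P \<union> set Q)"
      using inj_on_image_Pow[OF inj] Union_set_comps[OF P] Union_set_comps[OF Q]
      by (auto intro: inj_on_subset)
    then show "P = Q" using eq by (rule map_inj_on[rotated])
  qed
  moreover have "map ((`) h) ` set_comps A \<subseteq> set_comps B"
    using map_image_set_comps[OF inj] img by auto
  ultimately show ?thesis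
    using finite_set_comps[OF assms(2)] by (rule card_inj_on_le)
qed

text \<open>Deleting \<open>a\<close> from a composition whose first block contains \<open>a\<close> leaves an arbitrary
  composition of the other elements. It arises twice: \<open>a\<close> was alone in its block or was not.
  For \<open>A = {a}\<close> the second possibility does not occur.\<close>

lemma card_first_block_comps:
  assumes A: "finite A" "a \<in> A" "A \<noteq> {a}"
  shows "card (first_block_comps A a) = 2 * card (set_comps (A - {a}))"
proof -
  let ?C = "set_comps (A - {a})"
  let ?join = "\<lambda>P. insert a (hd P) # tl P"
  have ne: "\<exists>p P'. P = p # P' \<and> p \<noteq> {} \<and> a \<notin> p" if "P \<in> ?C" for P
    using that A by (cases P) auto
  have "first_block_comps A a = (#) {a} ` ?C \<union> ?join ` ?C"
  proof (intro equalityI subsetI)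
    fix P assume P: "P \<in> first_block_comps A a"
    then obtain p P' where p: "P = p # P'" "a \<in> p" "p \<subseteq> A" "P' \<in> set_comps (A - p)"
      using A(2) by (cases P) auto
    show "P \<in> (#) {a} ` ?C \<union> ?join ` ?C"
    proof (cases "p = {a}")
      case True
      then show ?thesis using p by auto
    next
      case False
      have "A - {a} - (p - {a}) = A - p" "insert a (p - {a}) = p" using p by auto
      moreover have "p - {a} \<noteq> {}" using p(2) False by auto
      ultimately show ?thesis
        using p by (intro UnI2 image_eqI[of _ _ "(p - {a}) # P'"]) auto
    qed
  next
    fix P assume "P \<in> (#) {a} ` ?C \<union> ?join ` ?C"
    then show "P \<in> first_block_comps A a"
    proof
      assume "P \<in> (#) {a} ` ?C"
      then show ?thesis using A by auto
    next
      assume "P \<in> ?join ` ?C"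
      then obtain Q where Q: "Q \<in> ?C" "P = ?join Q" by auto
      then obtain q Q' where q: "Q = q # Q'" using ne by blast
      have "A - {a} - q = A - insert a q" by auto
      then show ?thesis using Q q A by auto
    qed
  qed
  moreover have "(#) {a} ` ?C \<inter> ?join ` ?C = {}"
    using ne by fastforce
  moreover have "inj_on ?join ?C"
  proof (rule inj_onI)
    fix P Q assume "P \<in> ?C" "Q \<in> ?C" "?join P = ?join Q"
    then show "P = Q" using ne[of P] ne[of Q] by (auto dest: insert_ident)
  qed
  ultimately show ?thesis
    using finite_set_comps[of "A - {a}"] A(1)
    by (simp add: card_Un_disjoint card_image)
qed

lemma card_first_block_comps_singleton: "card (first_block_comps {a} a) = 1"
proof -
  have "first_block_comps {a} a = {[{a}]}"
  proof (intro equalityI subsetI)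
    fix P assume "P \<in> first_block_comps {a} a"
    then show "P \<in> {[{a}]}" by (cases P; cases "tl P") (auto simp: subset_singleton_iff)
  qed auto
  then show ?thesis by simp
qed

theorem corollary4p6:
  shows "lie_subalgebra (Prim :: 'a::field fpi set) \<and>
    internal_direct_sum (fin_subsets - {{}}) (\<lambda>A. right_ideal (e_elem A) A)
      (Prim :: 'a fpi set) \<and>
    (\<forall>A \<in> fin_subsets - {{}}.
      (Prim :: 'a fpi set) \<inter> FPi_comp A = right_ideal (e_elem A) A \<and>
      (right_ideal (e_elem A) A :: 'a fpi set) =
        free_vs.span {e \<in> FPi_comp A. idempotent e \<and>
          right_ideal e A = right_ideal (e_elem A) A} \<and>
      (2 \<le> card A \<longrightarrow>
        free_vs.dim (right_ideal (e_elem A) A :: 'a fpi set) =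
          2 * card (set_comps {1..card A - 1})) \<and>
      (card A = 1 \<longrightarrow>
        free_vs.dim (right_ideal (e_elem A) A :: 'a fpi set) = 1))"
proof (intro conjI ballI impI)
  show "lie_subalgebra (Prim :: 'a fpi set)" by (rule lie_subalgebra_Prim)
  have "internal_direct_sum (fin_subsets - {{}}) (\<lambda>A. right_ideal (e_elem A) A) (Prim :: 'a fpi set) \<longleftrightarrow>
      internal_direct_sum (fin_subsets - {{}}) (\<lambda>A. Prim \<inter> FPi_comp A) (Prim :: 'a fpi set)"
    unfolding internal_direct_sum_def by (simp add: right_ideal_e_elem subset_iff cong: conj_cong)
  then show "internal_direct_sum (fin_subsets - {{}}) (\<lambda>A. right_ideal (e_elem A) A) (Prim :: 'a fpi set)"
    using internal_direct_sum_Prim by simp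
next
  fix A :: "nat set" assume "A \<in> fin_subsets - {{}}"
  then have A: "A \<in> fin_subsets" "A \<noteq> {}" and fin: "finite A" by (auto simp: fin_subsets_def)
  note dim = dim_Prim_component[OF A, where 'a = 'a, folded right_ideal_e_elem[OF A]]
  show "(Prim :: 'a fpi set) \<inter> FPi_comp A = right_ideal (e_elem A) A"
    by (rule right_ideal_e_elem[OF A, symmetric])
  show "(right_ideal (e_elem A) A :: 'a fpi set) =
      free_vs.span {e \<in> FPi_comp A. idempotent e \<and> right_ideal e A = right_ideal (e_elem A) A}"
    by (rule right_ideal_eq_span_idempotents[OF A])
  show "free_vs.dim (right_ideal (e_elem A) A :: 'a fpi set) =
      2 * card (set_comps {1..card A - 1})" if "2 \<le> card A"
  proof -
    have "A \<noteq> {Min A}" using that by (metis One_nat_def Suc_1 card_1_singleton_iff Suc_n_not_le_n)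
    moreover have "card (A - {Min A}) = card {1..card A - 1}"
      using fin A(2) by (simp add: card_Diff_singleton)
    then have "card (set_comps (A - {Min A})) = card (set_comps {1..card A - 1})"
      using fin by (intro antisym card_set_comps_le) auto
    ultimately show ?thesis
      using dim card_first_block_comps[OF fin Min_in[OF fin A(2)]] by simp
  qed
  show "free_vs.dim (right_ideal (e_elem A) A :: 'a fpi set) = 1" if "card A = 1"
  proof -
    from that obtain a where "A = {a}" by (rule card_1_singletonE)
    then show ?thesis using dim card_first_block_comps_singleton by simp
  qed
qed

end
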